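(* Let $K\subseteq k((G))$ be a Hahn field with the canonical first lifting property and the canonical second lifting property. Then \begin{enumerate} \item[(i)] $\mathrm{ExtAut}\,K=\mathrm{ExtAut}_{(k)}K$; \item[(ii)] $v\text{-}\mathrm{Aut}_{(k)}K=\mathrm{IntAut}_kK\rtimes\mathrm{ExtAut}\,K$; \item[(iii)] $v\text{-}\mathrm{Aut}_{(k)}K\simeq\big(1\text{-}\mathrm{Aut}_kK\rtimes\mathrm{Hom}(G,k^\times)\big)\rtimes(\mathrm{Aut}\,k\times o\text{-}\mathrm{Aut}\,G)$; \item[(iv)] $v\text{-}\mathrm{Aut}_{(k)}K\simeq\mathrm{IntAut}_kK\rtimes\big(o\text{-}\mathrm{Aut}\,G\rtimes\mathrm{Aut}\,k\big)\simeq\big(\mathrm{IntAut}_kK\rtimes o\text{-}\mathrm{Aut}\,G\big)\rtimes\mathrm{Aut}\,k$. \end{enumerate}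
   Context: Let $k$ be a field and $(G,+,<)$ a totally ordered abelian group. $\mathbb K=k((G))$ is the field of all formal series $a=\sum_{g\in G}a_gt^g$ ($a_g\in k$) whose support $\operatorname{supp}a=\{g:a_g\neq 0\}$ is well ordered, with termwise addition and convolution product. $k(G)\subseteq\mathbb K$ is the fraction field of the group ring $k[G]$ (series with finite support). A Hahn field is a field $K$ with $k(G)\subseteq K\subseteq \mathbb K$. It carries the valuation $v(a)=\min\operatorname{supp}a$ for $a\neq0$, $v(0)=\infty$, with value group $G$. $\mathrm{Aut}\,k$ is the group of field automorphisms of $k$; $o\text{-}\mathrm{Aut}\,G$ is the group of order preserving automorphisms of $G$. $v\text{-}\mathrm{Aut}\,K$ is the group of valuation preserving automorphisms: field automorphisms $\sigma$ of $K$ for which there is $\tau\in o\text{-}\mathrm{Aut}\,G$ with $\tau(v(a))=v(\sigma(a))$ for all $a\in K^\times$. For any group of automorphisms of $K$, the subscript $(k)$ denotes the subgroup of those $\sigma$ with $\sigma(k)=k$, the subscript $k$ the subgroup of those with $\sigma|_k=\mathrm{id}_k$. For $\sigma\in v\text{-}\mathrm{Aut}\,K$ let $\sigma_G\in o\text{-}\mathrm{Aut}\,G$, $\sigma_G(v(a))=v(\sigma(a))$, and $\sigma_k\in\mathrm{Aut}\,k$, $\sigma_k(c)=\sigma(c)_0$ (constant term) for $c\in k$. $\mathrm{IntAut}\,K$ is the group of those $\sigma\in v\text{-}\mathrm{Aut}\,K$ with $\sigma_G=\mathrm{id}_G$ and $\sigma_k=\mathrm{id}_k$. For $(\rho,\tau)\in\mathrm{Aut}\,k\times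 o\text{-}\mathrm{Aut}\,G$ the canonical lift is $\widetilde{\rho\tau}\in v\text{-}\mathrm{Aut}\,\mathbb K$, $\widetilde{\rho\tau}(\sum a_gt^g)=\sum\rho(a_g)t^{\tau(g)}$. $K$ has the canonical first lifting property if $\widetilde{\rho\tau}(K)=K$ for all such $(\rho,\tau)$. In that case $\Psi_c\colon(\rho,\tau)\mapsto\widetilde{\rho\tau}|_K$ is an injective homomorphism into $v\text{-}\mathrm{Aut}\,K$, and $\mathrm{ExtAut}\,K:=\operatorname{im}\Psi_c$. $\mathrm{Hom}(G,k^\times)$ is the group, under pointwise multiplication, of homomorphisms $x\colon(G,+)\to(k^\times,\cdot)$, $x^g:=x(g)$. $K$ has the canonical second lifting property if $x\mapsto\rho_x$, $\rho_x(\sum a_gt^g)=\sum a_gx^gt^g$, is a well defined group homomorphism $\mathrm{Hom}(G,k^\times)\to\mathrm{IntAut}\,K$. The group of 1-automorphisms is $1\text{-}\mathrm{Aut}\,K:=\{\sigma\in\mathrm{IntAut}\,K:\sigma(t^g)_g=1\text{ for all }g\in G\}$. Semi-direct products are written with the normal factor on the left; equalities are inner semi-direct products, and in the isomorphisms the actions are induced by conjugation of automorphisms via the identifications $x\mapsto\rho_x$ and $(\rho,\tau)\mapsto\Psi_c(\rho,\tau)$. *)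

theory Defs
  imports "HOL-Algebra.Algebra"
begin

section \<open>Hahn series\<close>

text \<open>
  A formal series \<open>\<Sum>g. a\<^sub>g t\<^sup>g\<close> with coefficients in a field \<open>'k\<close> and exponents in a totally
  ordered abelian group \<open>'g\<close> is its coefficient function \<open>'g \<Rightarrow> 'k\<close>.
\<close>

definition hsupp :: "('g \<Rightarrow> 'k::zero) \<Rightarrow> 'g set"
  where "hsupp a = {g. a g \<noteq> 0}"

definition hconst :: "'k::zero \<Rightarrow> 'g::zero \<Rightarrow> 'k"
  where "hconst c = (\<lambda>g. if g = 0 then c else 0)"

definition hmonom :: "'g \<Rightarrow> 'g \<Rightarrow> 'k::zero_neq_one"
  where "hmonom g = (\<lambda>h. if h = g then 1 else 0)"

text \<open>
  The index set of the convolution sum is finite because both supports are well ordered.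
\<close>

definition hahn_series :: "('g::linordered_ab_group_add \<Rightarrow> 'k::field) ring"
  where "hahn_series =
    \<lparr>carrier = {a. well_order_on (hsupp a) (relation_of (\<le>) (hsupp a))},
     monoid.mult = \<lambda>a b n. \<Sum>g | a g \<noteq> 0 \<and> b (n - g) \<noteq> 0. a g * b (n - g),
     one = hconst 1,
     ring.zero = (\<lambda>g. 0),
     add = \<lambda>a b g. a g + b g\<rparr>"

definition group_ring :: "('g::linordered_ab_group_add \<Rightarrow> 'k::field) set"
  where "group_ring = {a. finite (hsupp a)}"

definition group_ring_fractions :: "('g::linordered_ab_group_add \<Rightarrow> 'k::field) set"
  where "group_ring_fractions =
    {p \<otimes>\<^bsub>hahn_series\<^esub> inv\<^bsub>hahn_series\<^esub> q | p q.
      p \<in> group_ring \<and> q \<in> group_ring \<and> q \<noteq> \<zero>\<^bsub>hahn_series\<^esub>}"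

definition hahn_field :: "('g::linordered_ab_group_add \<Rightarrow> 'k::field) set \<Rightarrow> bool"
  where "hahn_field K \<longleftrightarrow> subfield K hahn_series \<and> group_ring_fractions \<subseteq> K"

text \<open>Only used for nonzero series; the value \<open>v 0 = \<infinity>\<close> never enters.\<close>

definition hval :: "('g::linorder \<Rightarrow> 'k::zero) \<Rightarrow> 'g"
  where "hval a = (LEAST g. g \<in> hsupp a)"


section \<open>Automorphisms\<close>

definition field_auts :: "('k::field \<Rightarrow> 'k) set"
  where "field_auts = {\<rho>. bij \<rho> \<and> \<rho> 1 = 1 \<and>
    (\<forall>a b. \<rho> (a + b) = \<rho> a + \<rho> b) \<and> (\<forall>a b. \<rho> (a * b) = \<rho> a * \<rho> b)}"

definition order_auts :: "('g::linordered_ab_group_add \<Rightarrow> 'g) set"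
  where "order_auts = {\<tau>. bij \<tau> \<and> strict_mono \<tau> \<and> (\<forall>g h. \<tau> (g + h) = \<tau> g + \<tau> h)}"

text \<open>
  A set \<open>S\<close> of permutations of \<open>K\<close> as a group under composition. As in \<^const>\<open>Bij\<close>,
  a permutation of \<open>K\<close> is \<open>undefined\<close> outside \<open>K\<close>.
\<close>

definition aut_group :: "'a set \<Rightarrow> ('a \<Rightarrow> 'a) set \<Rightarrow> ('a \<Rightarrow> 'a) monoid"
  where "aut_group K S = BijGroup K \<lparr>carrier := S\<rparr>"

abbreviation Aut_k :: "('k::field \<Rightarrow> 'k) monoid"
  where "Aut_k \<equiv> aut_group UNIV field_auts"

abbreviation oAut_G :: "('g::linordered_ab_group_add \<Rightarrow> 'g) monoid"
  where "oAut_G \<equiv> aut_group UNIV order_auts"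

definition induces_on_values ::
    "('g::linordered_ab_group_add \<Rightarrow> 'k::field) set \<Rightarrow> (('g \<Rightarrow> 'k) \<Rightarrow> ('g \<Rightarrow> 'k)) \<Rightarrow> ('g \<Rightarrow> 'g) \<Rightarrow> bool"
  where "induces_on_values K \<sigma> \<tau> \<longleftrightarrow>
    \<tau> \<in> order_auts \<and> (\<forall>a\<in>K - {\<zero>\<^bsub>hahn_series\<^esub>}. \<tau> (hval a) = hval (\<sigma> a))"

definition vAut ::
    "('g::linordered_ab_group_add \<Rightarrow> 'k::field) set \<Rightarrow> (('g \<Rightarrow> 'k) \<Rightarrow> ('g \<Rightarrow> 'k)) set"
  where "vAut K =
    {\<sigma> \<in> ring_iso (hahn_series\<lparr>carrier := K\<rparr>) (hahn_series\<lparr>carrier := K\<rparr>) \<inter> extensional K.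
      \<exists>\<tau>. induces_on_values K \<sigma> \<tau>}"

definition value_aut ::
    "('g::linordered_ab_group_add \<Rightarrow> 'k::field) set \<Rightarrow> (('g \<Rightarrow> 'k) \<Rightarrow> ('g \<Rightarrow> 'k)) \<Rightarrow> 'g \<Rightarrow> 'g"
  where "value_aut K \<sigma> = (THE \<tau>. induces_on_values K \<sigma> \<tau>)"

definition residue_aut ::
    "(('g::linordered_ab_group_add \<Rightarrow> 'k::field) \<Rightarrow> ('g \<Rightarrow> 'k)) \<Rightarrow> 'k \<Rightarrow> 'k"
  where "residue_aut \<sigma> c = \<sigma> (hconst c) 0"

definition IntAut ::
    "('g::linordered_ab_group_add \<Rightarrow> 'k::field) set \<Rightarrow> (('g \<Rightarrow> 'k) \<Rightarrow> ('g \<Rightarrow> 'k)) set"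
  where "IntAut K = {\<sigma> \<in> vAut K. value_aut K \<sigma> = id \<and> residue_aut \<sigma> = id}"

definition oneAut ::
    "('g::linordered_ab_group_add \<Rightarrow> 'k::field) set \<Rightarrow> (('g \<Rightarrow> 'k) \<Rightarrow> ('g \<Rightarrow> 'k)) set"
  where "oneAut K = {\<sigma> \<in> IntAut K. \<forall>g. \<sigma> (hmonom g) g = 1}"

text \<open>
  The subscripts \<open>(k)\<close> and \<open>k\<close>: automorphisms stabilising, respectively fixing pointwise,
  the constant series.
\<close>

definition stab_k ::
    "(('g::zero \<Rightarrow> 'k::zero) \<Rightarrow> ('g \<Rightarrow> 'k)) set \<Rightarrow> (('g \<Rightarrow> 'k) \<Rightarrow> ('g \<Rightarrow> 'k)) set"
  where "stab_k S = {\<sigma> \<in> S. \<sigma> ` range hconst = range hconst}"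

definition fix_k ::
    "(('g::zero \<Rightarrow> 'k::zero) \<Rightarrow> ('g \<Rightarrow> 'k)) set \<Rightarrow> (('g \<Rightarrow> 'k) \<Rightarrow> ('g \<Rightarrow> 'k)) set"
  where "fix_k S = {\<sigma> \<in> S. \<forall>c. \<sigma> (hconst c) = hconst c}"


section \<open>Canonical lifts\<close>

text \<open>The coefficient of \<open>t\<^sup>h\<close> in \<open>\<Sum>g. \<rho> a\<^sub>g t\<^bsup>\<tau> g\<^esup>\<close> is the one with \<open>h = \<tau> g\<close>.\<close>

definition canonical_lift ::
    "('k \<Rightarrow> 'k) \<Rightarrow> ('g \<Rightarrow> 'g) \<Rightarrow> ('g \<Rightarrow> 'k) \<Rightarrow> ('g \<Rightarrow> 'k)"
  where "canonical_lift \<rho> \<tau> a = (\<lambda>h. \<rho> (a (inv_into UNIV \<tau> h)))"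

definition first_lifting_property ::
    "('g::linordered_ab_group_add \<Rightarrow> 'k::field) set \<Rightarrow> bool"
  where "first_lifting_property K \<longleftrightarrow>
    (\<forall>\<rho>\<in>field_auts. \<forall>\<tau>\<in>order_auts. canonical_lift \<rho> \<tau> ` K = K)"

definition Psi ::
    "('g \<Rightarrow> 'k) set \<Rightarrow> ('k \<Rightarrow> 'k) \<times> ('g \<Rightarrow> 'g) \<Rightarrow> ('g \<Rightarrow> 'k) \<Rightarrow> ('g \<Rightarrow> 'k)"
  where "Psi K = (\<lambda>(\<rho>, \<tau>). restrict (canonical_lift \<rho> \<tau>) K)"

definition ExtAut ::
    "('g::linordered_ab_group_add \<Rightarrow> 'k::field) set \<Rightarrow> (('g \<Rightarrow> 'k) \<Rightarrow> ('g \<Rightarrow> 'k)) set"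
  where "ExtAut K = Psi K ` (field_auts \<times> order_auts)"

definition Hom_G_kx :: "('g::linordered_ab_group_add \<Rightarrow> 'k::field) monoid"
  where "Hom_G_kx =
    \<lparr>carrier = {x. (\<forall>g. x g \<noteq> 0) \<and> (\<forall>g h. x (g + h) = x g * x h)},
     monoid.mult = \<lambda>x y g. x g * y g,
     one = (\<lambda>g. 1)\<rparr>"

definition rho ::
    "('g \<Rightarrow> 'k::times) set \<Rightarrow> ('g \<Rightarrow> 'k) \<Rightarrow> ('g \<Rightarrow> 'k) \<Rightarrow> ('g \<Rightarrow> 'k)"
  where "rho K x = (\<lambda>a\<in>K. \<lambda>g. a g * x g)"

definition second_lifting_property ::
    "('g::linordered_ab_group_add \<Rightarrow> 'k::field) set \<Rightarrow> bool"
  where "second_lifting_property K \<longleftrightarrow> rho K \<in> hom Hom_G_kx (aut_group K (IntAut K))"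


section \<open>Semi-direct products\<close>

definition inner_semidirect :: "'a monoid \<Rightarrow> 'a set \<Rightarrow> 'a set \<Rightarrow> bool"
  where "inner_semidirect A N H \<longleftrightarrow>
    N \<lhd> A \<and> subgroup H A \<and> N \<inter> H = {\<one>\<^bsub>A\<^esub>} \<and> N <#>\<^bsub>A\<^esub> H = carrier A"

text \<open>
  Let \<open>e\<close> and \<open>f\<close> identify the groups \<open>N\<close> and \<open>H\<close> with subgroups of a group \<open>A\<close>, the second
  normalising the first. Then conjugation in \<open>A\<close> induces an action of \<open>H\<close> on \<open>N\<close>, and the
  semi-direct product formed with it is the external one, on \<open>N \<times> H\<close>, normal factor on the left.
  Without \<open>acts_by_conj\<close> the value of \<open>conj_action\<close> is meaningless.
\<close>

definition acts_by_conj ::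
    "'a monoid \<Rightarrow> 'n monoid \<Rightarrow> ('n \<Rightarrow> 'a) \<Rightarrow> 'h monoid \<Rightarrow> ('h \<Rightarrow> 'a) \<Rightarrow> bool"
  where "acts_by_conj A N e H f \<longleftrightarrow>
    e \<in> hom N A \<and> inj_on e (carrier N) \<and> f \<in> hom H A \<and> inj_on f (carrier H) \<and>
    (\<forall>h\<in>carrier H. \<forall>n\<in>carrier N. f h \<otimes>\<^bsub>A\<^esub> e n \<otimes>\<^bsub>A\<^esub> inv\<^bsub>A\<^esub> f h \<in> e ` carrier N)"

definition conj_action ::
    "'a monoid \<Rightarrow> 'n monoid \<Rightarrow> ('n \<Rightarrow> 'a) \<Rightarrow> 'h monoid \<Rightarrow> ('h \<Rightarrow> 'a) \<Rightarrow> 'h \<Rightarrow> 'n \<Rightarrow> 'n"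
  where "conj_action A N e H f h n =
    inv_into (carrier N) e (f h \<otimes>\<^bsub>A\<^esub> e n \<otimes>\<^bsub>A\<^esub> inv\<^bsub>A\<^esub> f h)"

definition semidirect :: "'n monoid \<Rightarrow> 'h monoid \<Rightarrow> ('h \<Rightarrow> 'n \<Rightarrow> 'n) \<Rightarrow> ('n \<times> 'h) monoid"
  where "semidirect N H \<phi> =
    \<lparr>carrier = carrier N \<times> carrier H,
     monoid.mult = \<lambda>(n, h) (n', h'). (n \<otimes>\<^bsub>N\<^esub> \<phi> h n', h \<otimes>\<^bsub>H\<^esub> h'),
     one = (\<one>\<^bsub>N\<^esub>, \<one>\<^bsub>H\<^esub>)\<rparr>"

definition conj_semidirect ::
    "'a monoid \<Rightarrow> 'n monoid \<Rightarrow> ('n \<Rightarrow> 'a) \<Rightarrow> 'h monoid \<Rightarrow> ('h \<Rightarrow> 'a) \<Rightarrow> ('n \<times> 'h) monoid"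
  where "conj_semidirect A N e H f = semidirect N H (conj_action A N e H f)"

text \<open>The identification of such a semi-direct product with a subgroup of \<open>A\<close>.\<close>

definition join_embed :: "'a monoid \<Rightarrow> ('n \<Rightarrow> 'a) \<Rightarrow> ('h \<Rightarrow> 'a) \<Rightarrow> 'n \<times> 'h \<Rightarrow> 'a"
  where "join_embed A e f = (\<lambda>(n, h). e n \<otimes>\<^bsub>A\<^esub> f h)"

end

theory Submission
  imports Defs
begin

text \<open>
  An automorphism \<open>\<sigma>\<close> that preserves the valuation and stabilises the constants induces
  automorphisms \<open>\<rho>\<close> of \<open>k\<close> and \<open>\<tau>\<close> of \<open>G\<close>. Both assignments are homomorphisms, and the canonical lift
  of \<open>(\<rho>, \<tau>)\<close> induces \<open>\<rho>\<close> and \<open>\<tau>\<close> again. So sending \<open>\<sigma>\<close> to the lift of \<open>(\<rho>, \<tau>)\<close> is a retraction of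
  the group onto \<open>ExtAut K\<close>. Because \<open>\<sigma>\<close> stabilises the constants, \<open>\<rho> = id\<close> means that it fixes
  them; hence the kernel of the retraction is \<open>IntAut\<^sub>k K\<close>.

  A second retraction lives on \<open>IntAut\<^sub>k K\<close>. An internal automorphism that fixes \<open>k\<close> multiplies the
  leading coefficient of a series of value \<open>g\<close> by a factor that depends on \<open>g\<close> only
  (\<open>lead_coeff_Int\<close>): split off the leading term, whose coefficient is a fixed constant, and note that
  the remainder has larger value before and after. The factor is a character of \<open>G\<close>, it depends
  multiplicatively on the automorphism, and for \<open>\<rho>\<^sub>x\<close> it is \<open>x\<close>. The kernel consists of the
  1-automorphisms.

  Each semi-direct product in the theorem comes from a retraction of this kind: onto \<open>ExtAut K\<close>, onto
  the \<open>\<rho>\<^sub>x\<close>, or onto one of the two factors of \<open>ExtAut K\<close>. The locale \<open>split_subgroup\<close> turns a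
  retraction, with names for its kernel and its image, into the semi-direct product formed with
  conjugation, and shows that multiplying the two components identifies this product with the given
  subgroup. This identification is again an embedding of groups, so it may name the
  kernel or the image of a further retraction; that is how the nested products arise.
\<close>

section \<open>Recognising a semi-direct product\<close>

text \<open>
  The map \<open>p\<close> is a retraction of the subgroup \<open>B\<close> of \<open>A\<close> onto the image of \<open>f\<close>, and its kernel is the
  image of \<open>e\<close>. The factors \<open>N\<close> and \<open>H\<close> are abstract groups embedded by \<open>e\<close> and \<open>f\<close>, not subgroups of
  \<open>A\<close>, so that they can be semi-direct products themselves.
\<close>

locale split_subgroup = group A for A :: "'a monoid" (structure) +
  fixes B :: "'a set" and N :: "'n monoid" and e :: "'n \<Rightarrow> 'a"
    and H :: "'h monoid" and f :: "'h \<Rightarrow> 'a" and p :: "'a \<Rightarrow> 'a"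
  assumes B: "subgroup B A"
    and N: "group N" and e: "e \<in> hom N A" "inj_on e (carrier N)"
    and H: "group H" and f: "f \<in> hom H A" "inj_on f (carrier H)"
    and p: "p \<in> hom (A\<lparr>carrier := B\<rparr>) A"
    and f_B: "h \<in> carrier H \<Longrightarrow> f h \<in> B"
    and p_f: "h \<in> carrier H \<Longrightarrow> p (f h) = f h"
    and p_image: "b \<in> B \<Longrightarrow> p b \<in> f ` carrier H"
    and kernel: "e ` carrier N = {b \<in> B. p b = \<one>}"
begin

lemma e_iff: "x \<in> e ` carrier N \<longleftrightarrow> x \<in> B \<and> p x = \<one>"
  using kernel by blast

lemma B_closed:
  "x \<in> B \<Longrightarrow> x \<in> carrier A" "x \<in> B \<Longrightarrow> y \<in> B \<Longrightarrow> x \<otimes> y \<in> B" "x \<in> B \<Longrightarrow> inv x \<in> B"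
  using B by (auto simp: subgroup_def)

lemma p_mult: "x \<in> B \<Longrightarrow> y \<in> B \<Longrightarrow> p (x \<otimes> y) = p x \<otimes> p y"
  using p by (simp add: hom_def)

lemma p_inv: "x \<in> B \<Longrightarrow> p (inv x) = inv (p x)"
  using group_hom.hom_inv[of "A\<lparr>carrier := B\<rparr>" A p x] subgroup_imp_group[OF B] p
    m_inv_consistent[OF B]
  by (simp add: group_hom_def group_hom_axioms_def is_group)

text \<open>
  The image of \<open>e\<close> is a kernel in \<open>B\<close>, so it is invariant under conjugation by elements of \<open>B\<close>.
\<close>

lemma conj_in_image:
  assumes "h \<in> carrier H" "n \<in> carrier N"
  shows "f h \<otimes> e n \<otimes> inv (f h) \<in> e ` carrier N"
proof -
  have fh: "f h \<in> B" and en: "e n \<in> B" "p (e n) = \<one>"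
    using assms f_B e_iff[of "e n"] by auto
  then show ?thesis
    using assms B_closed by (simp add: e_iff p_mult p_inv p_f)
qed

lemma acts: "acts_by_conj A N e H f"
  unfolding acts_by_conj_def using e f conj_in_image by auto

lemma conj_action_closed:
  assumes "h \<in> carrier H" "n \<in> carrier N"
  shows "conj_action A N e H f h n \<in> carrier N"
    and "e (conj_action A N e H f h n) = f h \<otimes> e n \<otimes> inv (f h)"
  unfolding conj_action_def
  using conj_in_image[OF assms] by (auto intro: inv_into_into f_inv_into_f)

lemma e_carrier: "n \<in> carrier N \<Longrightarrow> e n \<in> carrier A"
  using e by (auto simp: hom_def)

lemma f_carrier: "h \<in> carrier H \<Longrightarrow> f h \<in> carrier A"
  using f by (auto simp: hom_def)

text \<open>
  The multiplication twisted by conjugation is made for this: the outer factors of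
  \<open>f h \<cdot> e n' \<cdot> (f h)\<^bsup>-1\<^esup> \<cdot> f h \<cdot> f h'\<close> cancel to \<open>f h \<cdot> e n' \<cdot> f h'\<close>.
\<close>

lemma join_embed_hom: "join_embed A e f \<in> hom (conj_semidirect A N e H f) A"
proof (rule homI)
  fix x assume "x \<in> carrier (conj_semidirect A N e H f)"
  then show "join_embed A e f x \<in> carrier A"
    by (auto simp: conj_semidirect_def semidirect_def join_embed_def e_carrier f_carrier)
next
  fix x y assume xy: "x \<in> carrier (conj_semidirect A N e H f)"
    "y \<in> carrier (conj_semidirect A N e H f)"
  obtain n h n' h' where [simp]: "x = (n, h)" "y = (n', h')" by (cases x; cases y)
  have c: "n \<in> carrier N" "h \<in> carrier H" "n' \<in> carrier N" "h' \<in> carrier H"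
    using xy by (auto simp: conj_semidirect_def semidirect_def)
  note [simp] = c e_carrier f_carrier conj_action_closed
  have "e n \<otimes> (f h \<otimes> e n' \<otimes> inv (f h)) \<otimes> (f h \<otimes> f h') = e n \<otimes> f h \<otimes> (e n' \<otimes> f h')"
    by (simp add: m_assoc inv_solve_left)
      (simp add: m_assoc[symmetric])
  then show "join_embed A e f (x \<otimes>\<^bsub>conj_semidirect A N e H f\<^esub> y) =
      join_embed A e f x \<otimes> join_embed A e f y"
    using e f by (simp add: conj_semidirect_def semidirect_def join_embed_def hom_mult)
qed

text \<open>
  The retraction recovers the component in \<open>H\<close>; this gives injectivity of the product map.
\<close>

lemma join_embed_p:
  assumes "n \<in> carrier N" "h \<in> carrier H"
  shows "join_embed A e f (n, h) \<in> B" "p (join_embed A e f (n, h)) = f h"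
proof -
  have "e n \<in> B" "p (e n) = \<one>" using assms e_iff[of "e n"] by auto
  then show "join_embed A e f (n, h) \<in> B" "p (join_embed A e f (n, h)) = f h"
    using assms by (auto simp: join_embed_def B_closed f_B p_mult p_f f_carrier)
qed

lemma join_embed_inj: "inj_on (join_embed A e f) (carrier (conj_semidirect A N e H f))"
proof (rule inj_onI)
  fix x y assume xy: "x \<in> carrier (conj_semidirect A N e H f)"
    "y \<in> carrier (conj_semidirect A N e H f)" and eq: "join_embed A e f x = join_embed A e f y"
  obtain n h n' h' where [simp]: "x = (n, h)" "y = (n', h')" by (cases x; cases y)
  have c: "n \<in> carrier N" "h \<in> carrier H" "n' \<in> carrier N" "h' \<in> carrier H"
    using xy by (auto simp: conj_semidirect_def semidirect_def)
  have "f h = f h'" using join_embed_p(2)[of n h] join_embed_p(2)[of n' h'] c eq by simp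
  then have h: "h = h'" using f(2) c by (auto dest: inj_onD)
  with eq have "e n = e n'" using c by (simp add: join_embed_def e_carrier f_carrier)
  then show "x = y" using h e(2) c by (auto dest: inj_onD)
qed

text \<open>
  Every \<open>b\<close> in \<open>B\<close> splits as \<open>(b \<cdot> (p b)\<^bsup>-1\<^esup>) \<cdot> p b\<close> with the first factor in the kernel of \<open>p\<close>.
\<close>

lemma join_embed_image: "join_embed A e f ` carrier (conj_semidirect A N e H f) = B"
proof
  show "join_embed A e f ` carrier (conj_semidirect A N e H f) \<subseteq> B"
    using join_embed_p(1) by (auto simp: conj_semidirect_def semidirect_def)
  show "B \<subseteq> join_embed A e f ` carrier (conj_semidirect A N e H f)"
  proof
    fix b assume b: "b \<in> B"
    obtain h where h: "h \<in> carrier H" "p b = f h" using p_image[OF b] by auto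
    have "b \<otimes> inv (f h) \<in> e ` carrier N"
      using b h by (simp add: e_iff B_closed f_B p_mult p_inv p_f f_carrier)
    then obtain n where n: "n \<in> carrier N" "b \<otimes> inv (f h) = e n" by auto
    have "b = join_embed A e f (n, h)"
      using b h B_closed f_carrier by (simp add: join_embed_def n(2)[symmetric] m_assoc)
    then show "b \<in> join_embed A e f ` carrier (conj_semidirect A N e H f)"
      using n h by (auto simp: conj_semidirect_def semidirect_def)
  qed
qed

text \<open>
  The group laws are pulled back from \<open>A\<close> along the injective map \<open>join_embed\<close>; this avoids
  checking that conjugation is an action by automorphisms.
\<close>

lemma group_semidirect: "group (conj_semidirect A N e H f)" (is "group ?S")
proof -
  interpret N: group N by (rule N)
  interpret H: group H by (rule H)
  let ?j = "join_embed A e f"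
  have one: "\<one>\<^bsub>?S\<^esub> \<in> carrier ?S"
    by (simp add: conj_semidirect_def semidirect_def)
  have j_one: "?j \<one>\<^bsub>?S\<^esub> = \<one>"
    using hom_one[OF e(1) N is_group] hom_one[OF f(1) H is_group]
    by (simp add: conj_semidirect_def semidirect_def join_embed_def)
  have closed: "x \<otimes>\<^bsub>?S\<^esub> y \<in> carrier ?S" if "x \<in> carrier ?S" "y \<in> carrier ?S" for x y
    using that by (auto simp: conj_semidirect_def semidirect_def conj_action_closed(1))
  have jc: "?j x \<in> carrier A" if "x \<in> carrier ?S" for x
    using that join_embed_image B_closed by blast
  note jm = hom_mult[OF join_embed_hom]
  have eqI: "x = y" if "x \<in> carrier ?S" "y \<in> carrier ?S" "?j x = ?j y" for x y
    using that join_embed_inj by (auto dest: inj_onD)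
  show ?thesis
  proof (rule groupI)
    fix x assume x: "x \<in> carrier ?S"
    have "inv (?j x) \<in> B" using x join_embed_image B_closed by blast
    then obtain y where y: "y \<in> carrier ?S" "?j y = inv (?j x)"
      using join_embed_image by (metis imageE)
    have "y \<otimes>\<^bsub>?S\<^esub> x = \<one>\<^bsub>?S\<^esub>"
      using x y by (intro eqI) (auto simp: one closed jm j_one jc)
    then show "\<exists>y\<in>carrier ?S. y \<otimes>\<^bsub>?S\<^esub> x = \<one>\<^bsub>?S\<^esub>" using y by blast
  qed (auto intro!: eqI simp: one closed jm j_one jc m_assoc)
qed

lemma iso_semidirect: "B = carrier A \<Longrightarrow> A \<cong> conj_semidirect A N e H f"
  using join_embed_hom join_embed_inj join_embed_image
  by (intro group.iso_sym[OF group_semidirect]) (auto simp: is_iso_def iso_def bij_betw_def)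

lemma inner_semidirect_of_split:
  assumes "B = carrier A"
  shows "inner_semidirect A (e ` carrier N) (f ` carrier H)"
proof -
  interpret p: group_hom A A p
    using p assms by unfold_locales simp
  have 1: "e ` carrier N \<lhd> A"
    using p.normal_kernel kernel assms by (simp add: kernel_def)
  have 2: "subgroup (f ` carrier H) A"
    using group_hom.img_is_subgroup[of H A f] H f is_group
    by (simp add: group_hom_def group_hom_axioms_def)
  have 3: "e ` carrier N \<inter> f ` carrier H = {\<one>}"
    using kernel p_f subgroup.one_closed[OF 2] normal_imp_subgroup[OF 1]
    by (auto dest: subgroup.one_closed)
  have 4: "e ` carrier N <#> f ` carrier H = carrier A"
  proof -
    have "e ` carrier N <#> f ` carrier H = join_embed A e f ` carrier (conj_semidirect A N e H f)"
      by (force simp: set_mult_def join_embed_def conj_semidirect_def semidirect_def)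
    then show ?thesis using join_embed_image assms by simp
  qed
  show ?thesis using 1 2 3 4 by (simp add: inner_semidirect_def)
qed

end

section \<open>Groups of permutations\<close>

lemma subgroup_BijGroupI:
  assumes "S \<subseteq> Bij M" "(\<lambda>x\<in>M. x) \<in> S"
    and "\<And>f g. f \<in> S \<Longrightarrow> g \<in> S \<Longrightarrow> compose M f g \<in> S"
    and "\<And>f. f \<in> S \<Longrightarrow> restrict (inv_into M f) M \<in> S"
  shows "subgroup S (BijGroup M)"
proof (rule group.subgroupI[OF group_BijGroup])
  show "S \<subseteq> carrier (BijGroup M)" "S \<noteq> {}" using assms by (auto simp: BijGroup_def)
  fix f assume f: "f \<in> S"
  then have "inv\<^bsub>BijGroup M\<^esub> f = restrict (inv_into M f) M"
    using assms(1) by (intro inv_BijGroup) auto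
  then show "inv\<^bsub>BijGroup M\<^esub> f \<in> S" using assms(4) f by simp
next
  fix f g assume fg: "f \<in> S" "g \<in> S"
  then have "f \<in> Bij M" "g \<in> Bij M" using assms(1) by auto
  then show "f \<otimes>\<^bsub>BijGroup M\<^esub> g \<in> S" using assms(3) fg by (simp add: BijGroup_def)
qed

lemma group_aut_group: "subgroup S (BijGroup M) \<Longrightarrow> group (aut_group M S)"
  unfolding aut_group_def by (rule group.subgroup_imp_group[OF group_BijGroup])

lemma aut_group_simps [simp]:
  "carrier (aut_group M S) = S" "\<one>\<^bsub>aut_group M S\<^esub> = (\<lambda>x\<in>M. x)"
  "(aut_group M S)\<lparr>carrier := T\<rparr> = aut_group M T"
  by (simp_all add: aut_group_def BijGroup_def)

lemma aut_group_mult: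
  "f \<in> Bij M \<Longrightarrow> g \<in> Bij M \<Longrightarrow> f \<otimes>\<^bsub>aut_group M S\<^esub> g = compose M f g"
  by (simp add: aut_group_def BijGroup_def)

lemma Bij_UNIV [simp]: "f \<in> Bij UNIV \<longleftrightarrow> bij f"
  by (auto simp: Bij_def extensional_def)

lemma compose_UNIV [simp]: "compose UNIV f g = f \<circ> g"
  by (auto simp: compose_def)

lemma group_Aut_k: "group (Aut_k :: ('k::field \<Rightarrow> 'k) monoid)"
proof (intro group_aut_group subgroup_BijGroupI)
  fix f g :: "'k \<Rightarrow> 'k" assume fg: "f \<in> field_auts"
  have inj: "inj f" and sur: "surj f" using fg by (auto simp: field_auts_def bij_def)
  have iff: "inv_into UNIV f x = y \<longleftrightarrow> x = f y" for x y
    using inj sur by (metis inv_f_f surj_f_inv_f)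
  have 1: "f (inv_into UNIV f x) = x" for x using sur by (simp add: surj_f_inv_f)
  show "restrict (inv_into UNIV f) UNIV \<in> field_auts"
    using fg by (simp add: field_auts_def bij_imp_bij_inv iff 1)
  assume "g \<in> field_auts"
  with fg show "compose UNIV f g \<in> field_auts"
    by (auto simp: field_auts_def bij_comp)
qed (auto simp: field_auts_def bij_def inj_on_def surj_def)

lemma order_auts_inv:
  assumes "\<tau> \<in> order_auts"
  shows "inv_into UNIV \<tau> \<in> order_auts" "\<tau> (inv_into UNIV \<tau> x) = x" "inv_into UNIV \<tau> (\<tau> x) = x"
proof -
  have inj: "inj \<tau>" and sur: "surj \<tau>" using assms by (auto simp: order_auts_def bij_def)
  have iff: "inv_into UNIV \<tau> x = y \<longleftrightarrow> x = \<tau> y" for x y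
    using inj sur by (metis inv_f_f surj_f_inv_f)
  have 1: "\<tau> (inv_into UNIV \<tau> x) = x" for x using sur by (simp add: surj_f_inv_f)
  then show "\<tau> (inv_into UNIV \<tau> x) = x" "inv_into UNIV \<tau> (\<tau> x) = x" using inj by simp_all
  have "strict_mono (inv_into UNIV \<tau>)"
  proof (rule strict_monoI)
    fix x y :: 'a assume "x < y"
    then have "\<tau> (inv_into UNIV \<tau> x) < \<tau> (inv_into UNIV \<tau> y)" by (simp add: 1)
    then show "inv_into UNIV \<tau> x < inv_into UNIV \<tau> y"
      using assms by (simp add: order_auts_def strict_mono_less)
  qed
  then show "inv_into UNIV \<tau> \<in> order_auts"
    using assms by (simp add: order_auts_def bij_imp_bij_inv iff 1)
qed

lemma group_oAut_G: "group (oAut_G :: ('g::linordered_ab_group_add \<Rightarrow> 'g) monoid)"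
proof (intro group_aut_group subgroup_BijGroupI)
  fix f g :: "'g \<Rightarrow> 'g" assume fg: "f \<in> order_auts"
  show "restrict (inv_into UNIV f) UNIV \<in> order_auts"
    using order_auts_inv(1)[OF fg] by (simp add: restrict_def)
  assume "g \<in> order_auts"
  with fg show "compose UNIV f g \<in> order_auts"
    by (auto simp: order_auts_def bij_comp strict_mono_def)
qed (auto simp: order_auts_def bij_def inj_on_def surj_def strict_mono_def)

lemma field_auts_0: "\<rho> \<in> field_auts \<Longrightarrow> \<rho> 0 = 0"
  unfolding field_auts_def by (metis (mono_tags, lifting) add_cancel_right_right mem_Collect_eq)

lemma field_auts_eq_0_iff: "\<rho> \<in> field_auts \<Longrightarrow> \<rho> x = 0 \<longleftrightarrow> x = 0"
  using field_auts_0[of \<rho>] by (auto simp: field_auts_def bij_def dest: injD[of \<rho> x 0])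

lemma order_auts_0: "\<tau> \<in> order_auts \<Longrightarrow> \<tau> 0 = 0"
  unfolding order_auts_def by (metis (mono_tags, lifting) add_cancel_right_right mem_Collect_eq)

lemma id_auts [simp]: "id \<in> field_auts" "id \<in> order_auts"
  by (auto simp: order_auts_def field_auts_def strict_mono_def)

lemma character_0:
  assumes "x \<in> carrier Hom_G_kx"
  shows "x 0 = (1::'k::field)"
proof -
  have "x 0 \<noteq> 0" "x (0 + 0) = x 0 * x 0"
    using assms by (simp_all add: Hom_G_kx_def del: add_0_left add_0_right)
  then show ?thesis by simp
qed

lemma group_Hom_G_kx: "group (Hom_G_kx :: ('g::linordered_ab_group_add \<Rightarrow> 'k::field) monoid)"
proof (rule groupI)
  fix x :: "'g \<Rightarrow> 'k" assume x: "x \<in> carrier Hom_G_kx"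
  then show "\<exists>y\<in>carrier Hom_G_kx. y \<otimes>\<^bsub>Hom_G_kx\<^esub> x = \<one>\<^bsub>Hom_G_kx\<^esub>"
    by (intro bexI[of _ "\<lambda>g. inverse (x g)"]) (auto simp: Hom_G_kx_def)
qed (auto simp: Hom_G_kx_def)

section \<open>Leading terms of Hahn series\<close>

text \<open>
  A general monomial \<open>c t\<^sup>g\<close>, the common form of constants and of \<open>hmonom\<close>.
\<close>

definition hterm :: "'k::zero \<Rightarrow> 'g \<Rightarrow> 'g \<Rightarrow> 'k"
  where "hterm c g = (\<lambda>h. if h = g then c else 0)"

lemma hconst_hterm: "hconst c = hterm c 0"
  by (simp add: hconst_def hterm_def)

lemma hmonom_hterm: "hmonom g = hterm 1 g"
  by (simp add: hmonom_def hterm_def)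

lemma hahn_series_simps [simp]:
  "\<zero>\<^bsub>hahn_series\<^esub> = (\<lambda>g. 0)" "\<one>\<^bsub>hahn_series\<^esub> = hconst 1"
  "a \<oplus>\<^bsub>hahn_series\<^esub> b = (\<lambda>g. a g + b g)"
  by (simp_all add: hahn_series_def)

lemma hahn_mult:
  "(a \<otimes>\<^bsub>hahn_series\<^esub> b) n = (\<Sum>g | a g \<noteq> 0 \<and> b (n - g) \<noteq> 0. a g * b (n - g))"
  by (simp add: hahn_series_def)

text \<open>
  Multiplying by \<open>c t\<^sup>h\<close> shifts exponents by \<open>h\<close> and scales by \<open>c\<close>: the convolution sum has at most
  one term.
\<close>

lemma hahn_mult_hterm:
  "a \<otimes>\<^bsub>hahn_series\<^esub> hterm c h = (\<lambda>n. a (n - h) * c)"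
proof
  fix n
  have "{g. a g \<noteq> 0 \<and> hterm c h (n - g) \<noteq> 0} = (if a (n - h) * c = 0 then {} else {n - h})"
    by (auto simp: hterm_def algebra_simps)
  then show "(a \<otimes>\<^bsub>hahn_series\<^esub> hterm c h) n = a (n - h) * c"
    by (auto simp: hahn_mult) (simp_all add: hterm_def)
qed

lemma hterm_mult: "hterm a g \<otimes>\<^bsub>hahn_series\<^esub> hterm b h = hterm (a * b) (g + h)"
  unfolding hahn_mult_hterm by (auto simp: hterm_def fun_eq_iff algebra_simps)

text \<open>
  A nonzero series has a nonempty well ordered support, so its value is an attained minimum.
\<close>

lemma hval_Least:
  assumes "a \<in> carrier hahn_series" "a \<noteq> (\<lambda>g. 0)"
  shows "a (hval a) \<noteq> 0" "a g \<noteq> 0 \<Longrightarrow> hval a \<le> g"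
proof -
  let ?S = "hsupp a"
  have "wf (relation_of (\<le>) ?S - Id)"
    using assms(1) by (simp add: hahn_series_def well_order_on_def)
  moreover obtain x where "x \<in> ?S" using assms(2) by (auto simp: hsupp_def fun_eq_iff)
  ultimately obtain m where m: "m \<in> ?S" "\<And>y. (y, m) \<in> relation_of (\<le>) ?S - Id \<Longrightarrow> y \<notin> ?S"
    using wfE_min by metis
  have least: "m \<le> y" if "y \<in> ?S" for y
    using m(2)[of y] that m(1) by (metis (no_types, lifting) DiffI case_prodI le_cases mem_Collect_eq
        mem_Sigma_iff pair_in_Id_conv order_refl relation_of_def)
  have "hval a = m"
    unfolding hval_def using m(1) least by (rule Least_equality)
  then show "a (hval a) \<noteq> 0" "a g \<noteq> 0 \<Longrightarrow> hval a \<le> g"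
    using m(1) least by (auto simp: hsupp_def)
qed

lemma hval_eqI:
  assumes "a v \<noteq> 0" "\<And>g. a g \<noteq> 0 \<Longrightarrow> v \<le> g"
  shows "hval a = v"
  unfolding hval_def using assms by (intro Least_equality) (auto simp: hsupp_def)

lemma hval_hterm [simp]: "c \<noteq> 0 \<Longrightarrow> hval (hterm c g) = g"
  by (rule hval_eqI) (auto simp: hterm_def split: if_splits)

text \<open>
  Exponents of \<open>a\<close> and \<open>b\<close> are at least \<open>hval a\<close> and \<open>hval b\<close>, so the only pair with sum
  \<open>hval a + hval b\<close> is the pair of values itself.
\<close>

lemma lead_coeff_mult:
  assumes a: "a \<in> carrier hahn_series" "a \<noteq> (\<lambda>g. 0)"
    and b: "b \<in> carrier hahn_series" "b \<noteq> (\<lambda>g. 0)"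
  shows "(a \<otimes>\<^bsub>hahn_series\<^esub> b) (hval a + hval b) = a (hval a) * b (hval b)"
proof -
  have "{g. a g \<noteq> 0 \<and> b (hval a + hval b - g) \<noteq> 0} = {hval a}"
  proof (intro subset_antisym subsetI)
    fix g assume "g \<in> {g. a g \<noteq> 0 \<and> b (hval a + hval b - g) \<noteq> 0}"
    then have "hval a \<le> g" "hval b \<le> hval a + hval b - g"
      using hval_Least(2)[OF a] hval_Least(2)[OF b] by auto
    then have "g \<le> hval a" by (simp add: le_diff_eq)
    with \<open>hval a \<le> g\<close> show "g \<in> {hval a}" by simp
  qed (use hval_Least(1)[OF a] hval_Least(1)[OF b] in auto)
  then show ?thesis by (simp add: hahn_mult)
qed

lemma canonical_lift_simps:
  assumes "\<rho> \<in> field_auts" "\<tau> \<in> order_auts"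
  shows "canonical_lift \<rho> \<tau> (\<lambda>g. a g + b g) = (\<lambda>g. canonical_lift \<rho> \<tau> a g + canonical_lift \<rho> \<tau> b g)"
    and "canonical_lift \<rho> \<tau> (a \<otimes>\<^bsub>hahn_series\<^esub> b) =
      canonical_lift \<rho> \<tau> a \<otimes>\<^bsub>hahn_series\<^esub> canonical_lift \<rho> \<tau> b"
    and "canonical_lift \<rho> \<tau> (hterm c g) = hterm (\<rho> c) (\<tau> g)"
proof -
  note inv = order_auts_inv[OF assms(2)]
  note \<rho>0 = field_auts_0[OF assms(1)]
  have \<rho>: "\<rho> (x + y) = \<rho> x + \<rho> y" "\<rho> (x * y) = \<rho> x * \<rho> y" for x y
    using assms(1) by (auto simp: field_auts_def)
  note \<rho>_iff = field_auts_eq_0_iff[OF assms(1)]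
  have \<tau>: "\<tau> (x + y) = \<tau> x + \<tau> y" for x y using assms(2) by (simp add: order_auts_def)
  have \<tau>_diff: "inv_into UNIV \<tau> (x - y) = inv_into UNIV \<tau> x - inv_into UNIV \<tau> y" for x y
  proof -
    have "inv_into UNIV \<tau> (x - y) + inv_into UNIV \<tau> y = inv_into UNIV \<tau> (x - y + y)"
      using inv(1) by (simp only: order_auts_def mem_Collect_eq)
    then show ?thesis by (simp add: algebra_simps)
  qed
  show "canonical_lift \<rho> \<tau> (\<lambda>g. a g + b g) = (\<lambda>g. canonical_lift \<rho> \<tau> a g + canonical_lift \<rho> \<tau> b g)"
    by (simp add: canonical_lift_def \<rho>)
  show "canonical_lift \<rho> \<tau> (hterm c g) = hterm (\<rho> c) (\<tau> g)"
    using inv(2,3) by (auto simp: canonical_lift_def hterm_def fun_eq_iff \<rho>0)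
  show "canonical_lift \<rho> \<tau> (a \<otimes>\<^bsub>hahn_series\<^esub> b) =
      canonical_lift \<rho> \<tau> a \<otimes>\<^bsub>hahn_series\<^esub> canonical_lift \<rho> \<tau> b"
  proof
    fix n
    \<comment> \<open>for infinite index sets both sums are \<open>0\<close>, so the series may be arbitrary functions\<close>
    have sum: "\<rho> (sum F S) = (\<Sum>x\<in>S. \<rho> (F x))" for F :: "'b \<Rightarrow> 'a" and S
      by (induction S rule: infinite_finite_induct) (simp_all add: \<rho> \<rho>0)
    let ?S = "{g. a g \<noteq> 0 \<and> b (inv_into UNIV \<tau> n - g) \<noteq> 0}"
    let ?T = "{g. \<rho> (a (inv_into UNIV \<tau> g)) \<noteq> 0 \<and> \<rho> (b (inv_into UNIV \<tau> (n - g))) \<noteq> 0}"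
    have "(\<Sum>g\<in>?S. \<rho> (a g) * \<rho> (b (inv_into UNIV \<tau> n - g))) =
      (\<Sum>g\<in>?T. \<rho> (a (inv_into UNIV \<tau> g)) * \<rho> (b (inv_into UNIV \<tau> (n - g))))"
      by (rule sum.reindex_bij_witness[of _ "inv_into UNIV \<tau>" \<tau>]) (auto simp: inv(2,3) \<tau>_diff \<rho>_iff)
    then show "canonical_lift \<rho> \<tau> (a \<otimes>\<^bsub>hahn_series\<^esub> b) n =
      (canonical_lift \<rho> \<tau> a \<otimes>\<^bsub>hahn_series\<^esub> canonical_lift \<rho> \<tau> b) n"
      by (simp add: canonical_lift_def hahn_mult sum \<rho>)
  qed
qed

lemma canonical_lift_compose:
  assumes "\<rho> \<in> field_auts" "\<tau> \<in> order_auts" "\<rho>' \<in> field_auts" "\<tau>' \<in> order_auts"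
  shows "canonical_lift \<rho> \<tau> (canonical_lift \<rho>' \<tau>' a) = canonical_lift (\<rho> \<circ> \<rho>') (\<tau> \<circ> \<tau>') a"
  using assms by (simp add: canonical_lift_def order_auts_def o_inv_distrib)

lemma canonical_lift_inj:
  assumes "\<rho> \<in> field_auts" "\<tau> \<in> order_auts"
  shows "inj (canonical_lift \<rho> \<tau>)"
proof (rule injI)
  fix a b assume eq: "canonical_lift \<rho> \<tau> a = canonical_lift \<rho> \<tau> b"
  have "inj \<rho>" using assms by (simp add: field_auts_def bij_def)
  moreover have "\<rho> (a g) = \<rho> (b g)" for g
    using fun_cong[OF eq, of "\<tau> g"] order_auts_inv(3)[OF assms(2)] by (simp add: canonical_lift_def)
  ultimately show "a = b" by (auto simp: inj_def fun_eq_iff)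
qed

lemma hval_canonical_lift:
  assumes "\<rho> \<in> field_auts" "\<tau> \<in> order_auts" "a \<in> carrier hahn_series" "a \<noteq> (\<lambda>g. 0)"
  shows "hval (canonical_lift \<rho> \<tau> a) = \<tau> (hval a)"
proof (rule hval_eqI)
  note \<rho>_iff = field_auts_eq_0_iff[OF assms(1)]
  note inv = order_auts_inv[OF assms(2)]
  show "canonical_lift \<rho> \<tau> a (\<tau> (hval a)) \<noteq> 0"
    using hval_Least(1)[OF assms(3,4)] by (simp add: canonical_lift_def \<rho>_iff inv)
  fix g assume "canonical_lift \<rho> \<tau> a g \<noteq> 0"
  then have "hval a \<le> inv_into UNIV \<tau> g"
    using hval_Least(2)[OF assms(3,4)] by (simp add: canonical_lift_def \<rho>_iff)
  then have "\<tau> (hval a) \<le> \<tau> (inv_into UNIV \<tau> g)"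
    using assms(2) by (simp add: order_auts_def strict_mono_less_eq)
  then show "\<tau> (hval a) \<le> g" by (simp add: inv)
qed


section \<open>Valuation preserving automorphisms\<close>

locale hahn =
  fixes K :: "('g::linordered_ab_group_add \<Rightarrow> 'k::field) set"
  assumes hahn_field: "hahn_field K"
begin

lemma K_closed:
  "K \<subseteq> carrier hahn_series" "(\<lambda>g. 0) \<in> K" "hconst 1 \<in> K"
  "a \<in> K \<Longrightarrow> b \<in> K \<Longrightarrow> a \<otimes>\<^bsub>hahn_series\<^esub> b \<in> K"
  "a \<in> K \<Longrightarrow> b \<in> K \<Longrightarrow> (\<lambda>g. a g + b g) \<in> K"
proof -
  have K: "subring K hahn_series"
    using hahn_field by (simp add: hahn_field_def subfield_def subdomain_def subcring_def)
  show "K \<subseteq> carrier hahn_series" "(\<lambda>g. 0) \<in> K" "hconst 1 \<in> K"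
    "a \<in> K \<Longrightarrow> b \<in> K \<Longrightarrow> a \<otimes>\<^bsub>hahn_series\<^esub> b \<in> K"
    "a \<in> K \<Longrightarrow> b \<in> K \<Longrightarrow> (\<lambda>g. a g + b g) \<in> K"
    using subringE[OF K] by simp_all
qed

text \<open>
  The group ring lies in \<open>K\<close> as the fractions with denominator \<open>1\<close>. The inverse in \<open>hahn_series\<close> is
  a definite description; for \<open>1\<close> it is evaluated by hand, from the fact that \<open>1\<close> is a right unit.
\<close>

lemma hterm_in_K: "hterm c g \<in> K"
proof -
  let ?R = "hahn_series :: ('g \<Rightarrow> 'k) ring"
  have unit: "a \<otimes>\<^bsub>?R\<^esub> hconst 1 = a" for a
    by (simp add: hconst_hterm hahn_mult_hterm)
  have "inv\<^bsub>?R\<^esub> hconst 1 = hconst 1"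
    unfolding m_inv_def
  proof (rule the_equality)
    show "hconst 1 \<in> carrier ?R \<and> hconst 1 \<otimes>\<^bsub>?R\<^esub> hconst 1 = \<one>\<^bsub>?R\<^esub> \<and>
        hconst 1 \<otimes>\<^bsub>?R\<^esub> hconst 1 = \<one>\<^bsub>?R\<^esub>"
      using K_closed by (auto simp: unit)
    fix y assume "y \<in> carrier ?R \<and> hconst 1 \<otimes>\<^bsub>?R\<^esub> y = \<one>\<^bsub>?R\<^esub> \<and> y \<otimes>\<^bsub>?R\<^esub> hconst 1 = \<one>\<^bsub>?R\<^esub>"
    then show "y = hconst 1" by (simp add: unit)
  qed
  then have "hterm c g = hterm c g \<otimes>\<^bsub>?R\<^esub> inv\<^bsub>?R\<^esub> hconst 1" by (simp add: unit)
  moreover have "hterm c g \<in> group_ring" "hconst 1 \<in> (group_ring :: ('g \<Rightarrow> 'k) set)"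
    by (auto simp: group_ring_def hsupp_def hterm_def hconst_def)
  moreover have "hconst 1 \<noteq> \<zero>\<^bsub>?R\<^esub>" by (auto simp: hconst_def fun_eq_iff)
  ultimately have "hterm c g \<in> group_ring_fractions"
    unfolding group_ring_fractions_def by blast
  then show ?thesis using hahn_field by (auto simp: hahn_field_def)
qed

lemma hconst_in_K: "hconst c \<in> K" and hmonom_in_K: "hmonom g \<in> K"
  by (simp_all add: hconst_hterm hmonom_hterm hterm_in_K)

lemma hmonom_nonzero: "(hmonom g :: 'g \<Rightarrow> 'k) \<noteq> (\<lambda>g. 0)"
  by (auto simp: hmonom_def fun_eq_iff)

lemma hconst_inj: "hconst c = (hconst d :: 'g \<Rightarrow> 'k) \<longleftrightarrow> c = d"
  by (auto simp: hconst_def fun_eq_iff)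

lemma hconst_add: "hconst (c + d) = (\<lambda>g. hconst c g + hconst d g :: 'k)"
  by (auto simp: hconst_def)

lemma hconst_mult: "hconst (c * d) = hconst c \<otimes>\<^bsub>hahn_series\<^esub> (hconst d :: 'g \<Rightarrow> 'k)"
  by (simp add: hconst_hterm hterm_mult)

lemma vAut_iff:
  "\<sigma> \<in> vAut K \<longleftrightarrow> \<sigma> \<in> Bij K \<and> \<sigma> (hconst 1) = hconst 1 \<and>
    (\<forall>a\<in>K. \<forall>b\<in>K. \<sigma> (\<lambda>g. a g + b g) = (\<lambda>g. \<sigma> a g + \<sigma> b g)) \<and>
    (\<forall>a\<in>K. \<forall>b\<in>K. \<sigma> (a \<otimes>\<^bsub>hahn_series\<^esub> b) = \<sigma> a \<otimes>\<^bsub>hahn_series\<^esub> \<sigma> b) \<and>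
    (\<exists>\<tau>. induces_on_values K \<sigma> \<tau>)"
  by (auto simp: vAut_def ring_iso_def ring_hom_def Bij_def bij_betw_def)

lemma vAutD:
  assumes "\<sigma> \<in> vAut K"
  shows "\<sigma> \<in> Bij K" "\<sigma> (hconst 1) = hconst 1"
    "a \<in> K \<Longrightarrow> b \<in> K \<Longrightarrow> \<sigma> (\<lambda>g. a g + b g) = (\<lambda>g. \<sigma> a g + \<sigma> b g)"
    "a \<in> K \<Longrightarrow> b \<in> K \<Longrightarrow> \<sigma> (a \<otimes>\<^bsub>hahn_series\<^esub> b) = \<sigma> a \<otimes>\<^bsub>hahn_series\<^esub> \<sigma> b"
    "\<exists>\<tau>. induces_on_values K \<sigma> \<tau>"
  using assms by (auto simp: vAut_iff)

lemma vAut_closed: "\<sigma> \<in> vAut K \<Longrightarrow> a \<in> K \<Longrightarrow> \<sigma> a \<in> K"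
  using vAutD(1) Bij_imp_funcset by blast

lemma vAut_inj: "\<sigma> \<in> vAut K \<Longrightarrow> a \<in> K \<Longrightarrow> b \<in> K \<Longrightarrow> \<sigma> a = \<sigma> b \<longleftrightarrow> a = b"
  using vAutD(1) by (auto simp: Bij_def bij_betw_def dest: inj_onD)

lemma vAut_zero:
  assumes "\<sigma> \<in> vAut K"
  shows "\<sigma> (\<lambda>g. 0) = (\<lambda>g. 0)"
proof -
  have "\<sigma> (\<lambda>g. 0) = (\<lambda>g. \<sigma> (\<lambda>g. 0) g + \<sigma> (\<lambda>g. 0) g)"
    using vAutD(3)[OF assms K_closed(2) K_closed(2)] by simp
  then have "\<sigma> (\<lambda>g. 0) g = \<sigma> (\<lambda>g. 0) g + \<sigma> (\<lambda>g. 0) g" for g by (rule fun_cong)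
  then show ?thesis by (metis add_cancel_right_right)
qed

lemma vAut_nonzero: "\<sigma> \<in> vAut K \<Longrightarrow> a \<in> K \<Longrightarrow> a \<noteq> (\<lambda>g. 0) \<Longrightarrow> \<sigma> a \<noteq> (\<lambda>g. 0)"
  using vAut_inj[of \<sigma> a "\<lambda>g. 0"] K_closed(2) vAut_zero by auto

text \<open>
  The induced automorphism of \<open>G\<close> is unique because every element of \<open>G\<close> is the value of a monomial.
\<close>

lemma value_aut_eqI:
  assumes "induces_on_values K \<sigma> \<tau>"
  shows "value_aut K \<sigma> = \<tau>"
  unfolding value_aut_def
proof (rule the_equality)
  show "induces_on_values K \<sigma> \<tau>" by (rule assms)
  fix \<tau>' assume \<tau>': "induces_on_values K \<sigma> \<tau>'"
  have "\<tau>' (hval (hmonom g :: 'g \<Rightarrow> 'k)) = \<tau> (hval (hmonom g :: 'g \<Rightarrow> 'k))" for g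
    using assms \<tau>' hmonom_in_K[of g] hmonom_nonzero[of g] by (simp add: induces_on_values_def)
  then show "\<tau>' = \<tau>" by (simp add: hmonom_hterm fun_eq_iff)
qed

lemma induces_value_aut: "\<sigma> \<in> vAut K \<Longrightarrow> induces_on_values K \<sigma> (value_aut K \<sigma>)"
  using vAutD(5) value_aut_eqI by metis

lemma value_aut_order: "\<sigma> \<in> vAut K \<Longrightarrow> value_aut K \<sigma> \<in> order_auts"
  using induces_value_aut by (auto simp: induces_on_values_def)

lemma hval_vAut:
  "\<sigma> \<in> vAut K \<Longrightarrow> a \<in> K \<Longrightarrow> a \<noteq> (\<lambda>g. 0) \<Longrightarrow> hval (\<sigma> a) = value_aut K \<sigma> (hval a)"
  using induces_value_aut by (auto simp: induces_on_values_def)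

lemma induces_compose:
  assumes "\<sigma> \<in> vAut K" "\<sigma>' \<in> vAut K"
  shows "induces_on_values K (compose K \<sigma> \<sigma>') (value_aut K \<sigma> \<circ> value_aut K \<sigma>')"
  unfolding induces_on_values_def
proof (intro conjI ballI)
  have "compose UNIV (value_aut K \<sigma>) (value_aut K \<sigma>') \<in> order_auts"
    using value_aut_order[OF assms(1)] value_aut_order[OF assms(2)]
    by (auto simp: order_auts_def bij_comp strict_mono_def)
  then show "value_aut K \<sigma> \<circ> value_aut K \<sigma>' \<in> order_auts" by simp
qed (use assms in \<open>auto simp: compose_eq hval_vAut vAut_closed vAut_nonzero\<close>)

lemma value_aut_compose:
  "\<sigma> \<in> vAut K \<Longrightarrow> \<sigma>' \<in> vAut K \<Longrightarrow>
    value_aut K (compose K \<sigma> \<sigma>') = value_aut K \<sigma> \<circ> value_aut K \<sigma>'"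
  by (rule value_aut_eqI[OF induces_compose])

lemma subgroup_vAut: "subgroup (vAut K) (BijGroup K)"
proof (rule subgroup_BijGroupI)
  show "vAut K \<subseteq> Bij K" using vAutD(1) by blast
  have "induces_on_values K (\<lambda>x\<in>K. x) id"
    by (simp add: induces_on_values_def)
  then show "(\<lambda>x\<in>K. x) \<in> vAut K"
    using K_closed by (auto simp: vAut_iff id_Bij)
  fix \<sigma> assume \<sigma>: "\<sigma> \<in> vAut K"
  show "compose K \<sigma> \<sigma>' \<in> vAut K" if \<sigma>': "\<sigma>' \<in> vAut K" for \<sigma>'
  proof -
    have "compose K \<sigma> \<sigma>' \<in> Bij K" using \<sigma> \<sigma>' by (simp add: compose_Bij vAutD)
    then show ?thesis
      unfolding vAut_iff[of "compose K \<sigma> \<sigma>'"]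
      using \<sigma> \<sigma>' K_closed induces_compose[OF \<sigma> \<sigma>']
      by (auto simp: compose_eq vAutD(2-4) vAut_closed)
  qed
  let ?\<iota> = "restrict (inv_into K \<sigma>) K" and ?\<tau> = "inv_into UNIV (value_aut K \<sigma>)"
  have img: "\<sigma> ` K = K" and inj: "inj_on \<sigma> K"
    using vAutD(1)[OF \<sigma>] by (auto simp: Bij_def bij_betw_def)
  have \<iota>: "inv_into K \<sigma> a \<in> K" "\<sigma> (inv_into K \<sigma> a) = a" if "a \<in> K" for a
    using that img by (metis inv_into_into, metis f_inv_into_f)
  have \<iota>_eqI: "inv_into K \<sigma> b = a" if "a \<in> K" "\<sigma> a = b" for a b
    using that inj by auto
  have "induces_on_values K ?\<iota> ?\<tau>"
    unfolding induces_on_values_def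
  proof (intro conjI ballI)
    note \<tau> = order_auts_inv[OF value_aut_order[OF \<sigma>]]
    show "?\<tau> \<in> order_auts" by (rule \<tau>)
    fix a assume a: "a \<in> K - {\<zero>\<^bsub>hahn_series\<^esub>}"
    then have "inv_into K \<sigma> a \<noteq> (\<lambda>g. 0)" using \<iota>(2)[of a] vAut_zero[OF \<sigma>] by auto
    then have "hval a = value_aut K \<sigma> (hval (inv_into K \<sigma> a))"
      using hval_vAut[OF \<sigma> \<iota>(1)[of a]] \<iota>(2)[of a] a by simp
    then show "?\<tau> (hval a) = hval (?\<iota> a)" using a by (simp add: \<tau>)
  qed
  then show "?\<iota> \<in> vAut K"
    using restrict_inv_into_Bij[OF vAutD(1)[OF \<sigma>]] K_closed
    by (auto simp: vAut_iff[of ?\<iota>] vAutD(2-4)[OF \<sigma>] \<iota> intro!: \<iota>_eqI)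
qed

section \<open>Automorphisms stabilising the constants\<close>

abbreviation "V \<equiv> aut_group K (stab_k (vAut K))"

lemma V_iff: "\<sigma> \<in> stab_k (vAut K) \<longleftrightarrow> \<sigma> \<in> vAut K \<and> \<sigma> ` range hconst = range hconst"
  by (auto simp: stab_k_def)

lemma V_hconst:
  assumes "\<sigma> \<in> stab_k (vAut K)"
  shows "\<sigma> (hconst c) = hconst (residue_aut \<sigma> c)"
proof -
  have "\<sigma> (hconst c) \<in> range hconst" using assms unfolding V_iff by blast
  then obtain d where "\<sigma> (hconst c) = hconst d" by blast
  then show ?thesis by (simp add: residue_aut_def hconst_def)
qed

text \<open>
  For an automorphism that stabilises the constants, \<open>residue_aut\<close> is its restriction to the
  constants, transported along \<open>hconst\<close>.
\<close>

lemma residue_aut_field: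
  assumes "\<sigma> \<in> stab_k (vAut K)"
  shows "residue_aut \<sigma> \<in> field_auts"
proof -
  have \<sigma>: "\<sigma> \<in> vAut K" "\<sigma> ` range hconst = range hconst" using assms by (auto simp: V_iff)
  note h = V_hconst[OF assms]
  have "inj (residue_aut \<sigma>)"
    using vAut_inj[OF \<sigma>(1) hconst_in_K hconst_in_K] by (auto simp: inj_def h hconst_inj)
  moreover have "surj (residue_aut \<sigma>)"
    unfolding surj_def
  proof
    fix d
    have "hconst d \<in> \<sigma> ` range hconst" using \<sigma>(2) by simp
    then show "\<exists>c. d = residue_aut \<sigma> c" by (auto simp: h hconst_inj)
  qed
  moreover have "hconst (residue_aut \<sigma> (c + d)) = (hconst (residue_aut \<sigma> c + residue_aut \<sigma> d) :: 'g \<Rightarrow> 'k)" for c d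
    using vAutD(3)[OF \<sigma>(1) hconst_in_K[of c] hconst_in_K[of d]]
    by (simp add: hconst_add[symmetric] h)
  moreover have "hconst (residue_aut \<sigma> (c * d)) = (hconst (residue_aut \<sigma> c * residue_aut \<sigma> d) :: 'g \<Rightarrow> 'k)" for c d
    using vAutD(4)[OF \<sigma>(1) hconst_in_K[of c] hconst_in_K[of d]]
    by (simp add: hconst_mult[symmetric] h)
  moreover have "hconst (residue_aut \<sigma> 1) = (hconst 1 :: 'g \<Rightarrow> 'k)"
    using vAutD(2)[OF \<sigma>(1)] by (simp add: h)
  ultimately show ?thesis by (simp add: field_auts_def bij_def hconst_inj)
qed

lemma subgroup_V: "subgroup (stab_k (vAut K)) (BijGroup K)"
proof (rule subgroup_BijGroupI)
  have sub: "range hconst \<subseteq> K" using hconst_in_K by auto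
  show "stab_k (vAut K) \<subseteq> Bij K" by (auto simp: V_iff vAutD)
  have "(\<lambda>x\<in>K. x) \<in> vAut K" using subgroup.one_closed[OF subgroup_vAut] by (simp add: BijGroup_def)
  then show "(\<lambda>x\<in>K. x) \<in> stab_k (vAut K)"
    using sub by (auto simp: V_iff image_iff subset_iff)
  fix \<sigma> assume \<sigma>: "\<sigma> \<in> stab_k (vAut K)"
  then have v: "\<sigma> \<in> vAut K" "\<sigma> ` range hconst = range hconst" by (auto simp: V_iff)
  show "compose K \<sigma> \<sigma>' \<in> stab_k (vAut K)" if "\<sigma>' \<in> stab_k (vAut K)" for \<sigma>'
  proof -
    have v': "\<sigma>' \<in> vAut K" "\<sigma>' ` range hconst = range hconst" using that by (auto simp: V_iff)
    have "compose K \<sigma> \<sigma>' = \<sigma> \<otimes>\<^bsub>BijGroup K\<^esub> \<sigma>'" using v v' by (simp add: BijGroup_def vAutD)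
    then have "compose K \<sigma> \<sigma>' \<in> vAut K"
      using subgroup.m_closed[OF subgroup_vAut v(1) v'(1)] by simp
    moreover have "compose K \<sigma> \<sigma>' ` range hconst = \<sigma> ` \<sigma>' ` range hconst"
      unfolding image_image by (rule image_cong) (use sub in \<open>auto simp: compose_eq hconst_in_K\<close>)
    ultimately show ?thesis using v v' by (simp add: V_iff)
  qed
  have "inv\<^bsub>BijGroup K\<^esub> \<sigma> = restrict (inv_into K \<sigma>) K" using v by (simp add: inv_BijGroup vAutD)
  then have "restrict (inv_into K \<sigma>) K \<in> vAut K"
    using subgroup.m_inv_closed[OF subgroup_vAut v(1)] by simp
  moreover have "restrict (inv_into K \<sigma>) K ` range hconst = range hconst"
  proof -
    have inj: "inj_on \<sigma> K" using vAutD(1)[OF v(1)] by (auto simp: Bij_def bij_betw_def)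
    have "restrict (inv_into K \<sigma>) K ` range hconst = inv_into K \<sigma> ` range hconst"
      by (rule image_cong) (use sub in auto)
    also have "\<dots> = inv_into K \<sigma> ` \<sigma> ` range hconst" by (simp only: v(2))
    also have "\<dots> = range hconst" using inj sub by (rule inv_into_image_cancel)
    finally show ?thesis .
  qed
  ultimately show "restrict (inv_into K \<sigma>) K \<in> stab_k (vAut K)" by (simp add: V_iff)
qed

lemma group_V: "group V"
  by (rule group_aut_group[OF subgroup_V])

lemma V_mult:
  "\<sigma> \<in> stab_k (vAut K) \<Longrightarrow> \<sigma>' \<in> stab_k (vAut K) \<Longrightarrow> \<sigma> \<otimes>\<^bsub>aut_group K S\<^esub> \<sigma>' = compose K \<sigma> \<sigma>'"
  by (simp add: aut_group_mult vAutD V_iff)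

lemma residue_aut_compose:
  assumes "\<sigma> \<in> stab_k (vAut K)" "\<sigma>' \<in> stab_k (vAut K)"
  shows "residue_aut (compose K \<sigma> \<sigma>') = residue_aut \<sigma> \<circ> residue_aut \<sigma>'"
proof
  fix c
  have "compose K \<sigma> \<sigma>' (hconst c) = \<sigma> (hconst (residue_aut \<sigma>' c))"
    using V_hconst[OF assms(2)] by (simp add: compose_eq hconst_in_K)
  then show "residue_aut (compose K \<sigma> \<sigma>') c = (residue_aut \<sigma> \<circ> residue_aut \<sigma>') c"
    by (simp add: residue_aut_def)
qed

lemma residue_hom: "residue_aut \<in> hom V Aut_k"
proof (rule homI)
  fix \<sigma> \<sigma>' assume \<sigma>: "\<sigma> \<in> carrier V" "\<sigma>' \<in> carrier V"
  then have "bij (residue_aut \<sigma>)" "bij (residue_aut \<sigma>')"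
    using residue_aut_field by (auto simp: field_auts_def)
  then show "residue_aut (\<sigma> \<otimes>\<^bsub>V\<^esub> \<sigma>') = residue_aut \<sigma> \<otimes>\<^bsub>Aut_k\<^esub> residue_aut \<sigma>'"
    using \<sigma> by (simp add: V_mult residue_aut_compose aut_group_mult)
qed (simp add: residue_aut_field)

lemma value_hom: "value_aut K \<in> hom V oAut_G"
proof (rule homI)
  fix \<sigma> \<sigma>' assume "\<sigma> \<in> carrier V" "\<sigma>' \<in> carrier V"
  then show "value_aut K (\<sigma> \<otimes>\<^bsub>V\<^esub> \<sigma>') = value_aut K \<sigma> \<otimes>\<^bsub>oAut_G\<^esub> value_aut K \<sigma>'"
    using value_aut_order
    by (auto simp: V_mult value_aut_compose V_iff order_auts_def aut_group_mult)
qed (auto simp: V_iff value_aut_order)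

text \<open>
  Among the automorphisms stabilising \<open>k\<close>, those fixing \<open>k\<close> pointwise are those with trivial
  residue automorphism. So \<open>IntAut\<^sub>k K\<close> is a kernel.
\<close>

lemma fix_IntAut_iff:
  "\<sigma> \<in> fix_k (IntAut K) \<longleftrightarrow>
    \<sigma> \<in> stab_k (vAut K) \<and> residue_aut \<sigma> = id \<and> value_aut K \<sigma> = id"
proof
  assume "\<sigma> \<in> fix_k (IntAut K)"
  then show "\<sigma> \<in> stab_k (vAut K) \<and> residue_aut \<sigma> = id \<and> value_aut K \<sigma> = id"
    by (auto simp: fix_k_def IntAut_def V_iff image_iff)
next
  assume \<sigma>: "\<sigma> \<in> stab_k (vAut K) \<and> residue_aut \<sigma> = id \<and> value_aut K \<sigma> = id"
  then show "\<sigma> \<in> fix_k (IntAut K)"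
    using V_hconst[of \<sigma>] by (auto simp: fix_k_def IntAut_def V_iff)
qed

section \<open>Leading coefficients of internal automorphisms\<close>

definition lead_char :: "(('g \<Rightarrow> 'k) \<Rightarrow> ('g \<Rightarrow> 'k)) \<Rightarrow> 'g \<Rightarrow> 'k"
  where "lead_char \<sigma> g = \<sigma> (hmonom g) g"

lemma Int_hval: "\<sigma> \<in> fix_k (IntAut K) \<Longrightarrow> a \<in> K \<Longrightarrow> a \<noteq> (\<lambda>g. 0) \<Longrightarrow> hval (\<sigma> a) = hval a"
  by (auto simp: fix_IntAut_iff V_iff hval_vAut)

text \<open>
  Write \<open>a = c t\<^sup>v + b\<close> with \<open>v = hval a\<close> and \<open>b\<close> of larger value or zero. Then \<open>\<sigma> b\<close> has no term at \<open>v\<close>,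
  and \<open>\<sigma>\<close> fixes the constant \<open>c\<close>.
\<close>

lemma lead_coeff_Int:
  assumes \<sigma>: "\<sigma> \<in> fix_k (IntAut K)" and a: "a \<in> K" "a \<noteq> (\<lambda>g. 0)"
  shows "\<sigma> a (hval a) = a (hval a) * lead_char \<sigma> (hval a)"
proof -
  let ?v = "hval a" and ?c = "a (hval a)"
  have aC: "a \<in> carrier hahn_series" using a K_closed by auto
  have v: "\<sigma> \<in> vAut K" using \<sigma> by (simp add: fix_IntAut_iff V_iff)
  define b where "b = (\<lambda>g. a g + hterm (- ?c) ?v g)"
  have b: "b \<in> K" unfolding b_def using a(1) hterm_in_K by (rule K_closed(5))
  have \<sigma>b: "\<sigma> b ?v = 0"
  proof (cases "b = (\<lambda>g. 0)")
    case True
    then show ?thesis using vAut_zero[OF v] by simp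
  next
    case False
    have bC: "b \<in> carrier hahn_series" using b K_closed by auto
    have "b (hval b) \<noteq> 0" by (rule hval_Least(1)[OF bC False])
    then have "hval b \<noteq> ?v" "a (hval b) \<noteq> 0" by (auto simp: b_def hterm_def split: if_splits)
    then have "?v < hval b" using hval_Least(2)[OF aC a(2)] by (metis order_le_less)
    also have "hval b = hval (\<sigma> b)" using Int_hval[OF \<sigma> b False] by simp
    finally have "\<not> hval (\<sigma> b) \<le> ?v" by simp
    moreover have "\<sigma> b \<in> carrier hahn_series" using vAut_closed[OF v b] K_closed by auto
    ultimately show ?thesis using hval_Least(2)[OF _ vAut_nonzero[OF v b False]] by blast
  qed
  have term_eq: "hterm ?c ?v = hmonom ?v \<otimes>\<^bsub>hahn_series\<^esub> hconst ?c"
    by (simp add: hmonom_hterm hconst_hterm hterm_mult)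
  have "\<sigma> (hterm ?c ?v) = \<sigma> (hmonom ?v) \<otimes>\<^bsub>hahn_series\<^esub> hconst ?c"
    unfolding term_eq using vAutD(4)[OF v hmonom_in_K hconst_in_K] \<sigma> by (simp add: fix_k_def)
  then have 1: "\<sigma> (hterm ?c ?v) ?v = lead_char \<sigma> ?v * ?c"
    by (simp add: hconst_hterm hahn_mult_hterm lead_char_def)
  have "a = (\<lambda>g. b g + hterm ?c ?v g)" by (auto simp: b_def hterm_def)
  then have "\<sigma> a = (\<lambda>g. \<sigma> b g + \<sigma> (hterm ?c ?v) g)"
    using vAutD(3)[OF v b hterm_in_K] by metis
  then show ?thesis by (simp add: 1 \<sigma>b)
qed

lemma lead_char_in_Hom:
  assumes \<sigma>: "\<sigma> \<in> fix_k (IntAut K)"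
  shows "lead_char \<sigma> \<in> carrier Hom_G_kx"
proof -
  have v: "\<sigma> \<in> vAut K" using \<sigma> by (simp add: fix_IntAut_iff V_iff)
  have c: "\<sigma> (hmonom g) \<in> carrier hahn_series" "\<sigma> (hmonom g) \<noteq> (\<lambda>g. 0)" for g
    using vAut_closed[OF v hmonom_in_K[of g]] vAut_nonzero[OF v hmonom_in_K hmonom_nonzero, of g]
      K_closed by auto
  have hv: "hval (\<sigma> (hmonom g)) = g" for g
    using Int_hval[OF \<sigma> hmonom_in_K hmonom_nonzero] by (simp add: hmonom_hterm)
  have "lead_char \<sigma> g \<noteq> 0" for g
    using hval_Least(1)[OF c[of g]] by (simp add: lead_char_def hv)
  moreover have "lead_char \<sigma> (g + h) = lead_char \<sigma> g * lead_char \<sigma> h" for g h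
  proof -
    have "hmonom (g + h) = hmonom g \<otimes>\<^bsub>hahn_series\<^esub> (hmonom h :: 'g \<Rightarrow> 'k)"
      by (simp add: hmonom_hterm hterm_mult)
    then show ?thesis
      using lead_coeff_mult[OF c[of g] c[of h]] vAutD(4)[OF v hmonom_in_K hmonom_in_K]
      by (simp add: lead_char_def hv)
  qed
  ultimately show ?thesis by (simp add: Hom_G_kx_def)
qed

text \<open>
  The series \<open>\<sigma>' (hmonom g)\<close> has value \<open>g\<close>, so \<open>\<sigma>\<close> multiplies its leading coefficient by
  \<open>lead_char \<sigma> g\<close>.
\<close>

lemma lead_char_hom: "lead_char \<in> hom (aut_group K (fix_k (IntAut K))) Hom_G_kx"
proof (rule homI)
  fix \<sigma> \<sigma>' assume "\<sigma> \<in> carrier (aut_group K (fix_k (IntAut K)))"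
    "\<sigma>' \<in> carrier (aut_group K (fix_k (IntAut K)))"
  then have \<sigma>: "\<sigma> \<in> fix_k (IntAut K)" "\<sigma>' \<in> fix_k (IntAut K)" by simp_all
  then have v: "\<sigma>' \<in> vAut K" "\<sigma> \<in> stab_k (vAut K)" "\<sigma>' \<in> stab_k (vAut K)"
    by (simp_all add: fix_IntAut_iff V_iff)
  have "lead_char (compose K \<sigma> \<sigma>') g = lead_char \<sigma> g * lead_char \<sigma>' g" for g
  proof -
    have "hval (\<sigma>' (hmonom g)) = g"
      using Int_hval[OF \<sigma>(2) hmonom_in_K hmonom_nonzero] by (simp add: hmonom_hterm)
    then have "\<sigma> (\<sigma>' (hmonom g)) g = \<sigma>' (hmonom g) g * lead_char \<sigma> g"
      using lead_coeff_Int[OF \<sigma>(1) vAut_closed[OF v(1) hmonom_in_K]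
          vAut_nonzero[OF v(1) hmonom_in_K hmonom_nonzero], of g] by simp
    then show ?thesis by (simp add: lead_char_def compose_eq hmonom_in_K mult.commute)
  qed
  then show "lead_char (\<sigma> \<otimes>\<^bsub>aut_group K (fix_k (IntAut K))\<^esub> \<sigma>') =
      lead_char \<sigma> \<otimes>\<^bsub>Hom_G_kx\<^esub> lead_char \<sigma>'"
    using v by (simp add: V_mult Hom_G_kx_def fun_eq_iff)
qed (simp add: lead_char_in_Hom)

end

section \<open>Canonical lifts as automorphisms\<close>

locale hahn_lifting = hahn K for K :: "('g::linordered_ab_group_add \<Rightarrow> 'k::field) set" +
  assumes first_lifting: "first_lifting_property K"
    and second_lifting: "second_lifting_property K"
begin

abbreviation "Int_k \<equiv> aut_group K (fix_k (IntAut K))"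
abbreviation "One_k \<equiv> aut_group K (fix_k (oneAut K))"
abbreviation "\<Psi>G \<equiv> \<lambda>\<tau>. Psi K (id, \<tau>)"
abbreviation "\<Psi>k \<equiv> \<lambda>\<rho>. Psi K (\<rho>, id)"

lemma Psi_eq: "a \<in> K \<Longrightarrow> Psi K (\<rho>, \<tau>) a = canonical_lift \<rho> \<tau> a"
  by (simp add: Psi_def)

lemma canonical_lift_in_K:
  "\<rho> \<in> field_auts \<Longrightarrow> \<tau> \<in> order_auts \<Longrightarrow> a \<in> K \<Longrightarrow> canonical_lift \<rho> \<tau> a \<in> K"
  using first_lifting by (auto simp: first_lifting_property_def)

lemma Psi_hconst:
  assumes "\<rho> \<in> field_auts" "\<tau> \<in> order_auts"
  shows "Psi K (\<rho>, \<tau>) (hconst c) = hconst (\<rho> c)"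
  by (simp add: Psi_eq hconst_in_K)
    (simp add: hconst_hterm canonical_lift_simps[OF assms] order_auts_0 assms)

lemma induces_Psi:
  assumes "\<rho> \<in> field_auts" "\<tau> \<in> order_auts"
  shows "induces_on_values K (Psi K (\<rho>, \<tau>)) \<tau>"
  using assms K_closed(1)
  by (auto simp: induces_on_values_def Psi_eq hval_canonical_lift subset_iff)

lemma Psi_in_V:
  assumes "\<rho> \<in> field_auts" "\<tau> \<in> order_auts"
  shows "Psi K (\<rho>, \<tau>) \<in> stab_k (vAut K)"
proof -
  have "bij_betw (canonical_lift \<rho> \<tau>) K K"
    using canonical_lift_inj[OF assms] first_lifting assms
    by (auto simp: bij_betw_def first_lifting_property_def intro: inj_on_subset)
  then have "bij_betw (Psi K (\<rho>, \<tau>)) K K"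
    by (subst bij_betw_cong[of K _ "canonical_lift \<rho> \<tau>"]) (auto simp: Psi_eq)
  then have "Psi K (\<rho>, \<tau>) \<in> Bij K" by (simp add: Bij_def Psi_def)
  moreover have "Psi K (\<rho>, \<tau>) (hconst 1) = hconst 1"
    using assms by (simp add: Psi_hconst field_auts_def)
  ultimately have "Psi K (\<rho>, \<tau>) \<in> vAut K"
    using induces_Psi[OF assms] K_closed
    by (auto simp: vAut_iff Psi_eq canonical_lift_simps[OF assms])
  moreover have "Psi K (\<rho>, \<tau>) ` range hconst = range hconst"
  proof -
    have "range \<rho> = UNIV" using assms by (simp add: field_auts_def bij_def)
    moreover have "Psi K (\<rho>, \<tau>) ` range hconst = hconst ` range \<rho>"
      unfolding image_image by (simp add: Psi_hconst[OF assms])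
    ultimately show ?thesis by simp
  qed
  ultimately show ?thesis by (simp add: V_iff)
qed

lemma residue_Psi: "\<rho> \<in> field_auts \<Longrightarrow> \<tau> \<in> order_auts \<Longrightarrow> residue_aut (Psi K (\<rho>, \<tau>)) = \<rho>"
  by (simp add: residue_aut_def fun_eq_iff Psi_hconst) (simp add: hconst_def)

lemma value_Psi: "\<rho> \<in> field_auts \<Longrightarrow> \<tau> \<in> order_auts \<Longrightarrow> value_aut K (Psi K (\<rho>, \<tau>)) = \<tau>"
  by (rule value_aut_eqI[OF induces_Psi])

lemma Psi_hom: "Psi K \<in> hom (Aut_k \<times>\<times> oAut_G) V"
proof (rule homI)
  fix x y :: "('k \<Rightarrow> 'k) \<times> ('g \<Rightarrow> 'g)"
  assume "x \<in> carrier (Aut_k \<times>\<times> oAut_G)" "y \<in> carrier (Aut_k \<times>\<times> oAut_G)"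
  then obtain \<rho> \<tau> \<rho>' \<tau>' where [simp]: "x = (\<rho>, \<tau>)" "y = (\<rho>', \<tau>')" and
    a: "\<rho> \<in> field_auts" "\<tau> \<in> order_auts" "\<rho>' \<in> field_auts" "\<tau>' \<in> order_auts"
    by (auto simp: DirProd_def)
  have "Psi K (\<rho> \<circ> \<rho>', \<tau> \<circ> \<tau>') = compose K (Psi K (\<rho>, \<tau>)) (Psi K (\<rho>', \<tau>'))"
    using a by (auto simp: Psi_def compose_def canonical_lift_compose canonical_lift_in_K)
  then show "Psi K (x \<otimes>\<^bsub>Aut_k \<times>\<times> oAut_G\<^esub> y) = Psi K x \<otimes>\<^bsub>V\<^esub> Psi K y"
    using a by (simp add: V_mult Psi_in_V) (simp add: aut_group_mult field_auts_def order_auts_def)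
qed (auto simp: Psi_in_V)

lemma PsiG_hom: "\<Psi>G \<in> hom oAut_G V"
proof (rule homI)
  fix \<tau> \<tau>' :: "'g \<Rightarrow> 'g" assume "\<tau> \<in> carrier oAut_G" "\<tau>' \<in> carrier oAut_G"
  then show "\<Psi>G (\<tau> \<otimes>\<^bsub>oAut_G\<^esub> \<tau>') = \<Psi>G \<tau> \<otimes>\<^bsub>V\<^esub> \<Psi>G \<tau>'"
    using hom_mult[OF Psi_hom, of "(id, \<tau>)" "(id, \<tau>')"] by (simp add: aut_group_mult)
qed (simp add: Psi_in_V)

lemma Psik_hom: "\<Psi>k \<in> hom Aut_k V"
proof (rule homI)
  fix \<rho> \<rho>' :: "'k \<Rightarrow> 'k" assume "\<rho> \<in> carrier Aut_k" "\<rho>' \<in> carrier Aut_k"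
  then show "\<Psi>k (\<rho> \<otimes>\<^bsub>Aut_k\<^esub> \<rho>') = \<Psi>k \<rho> \<otimes>\<^bsub>V\<^esub> \<Psi>k \<rho>'"
    using hom_mult[OF Psi_hom, of "(\<rho>, id)" "(\<rho>', id)"] by (simp add: aut_group_mult)
qed (simp add: Psi_in_V)

lemma Psi_eq_iff:
  assumes "\<rho> \<in> field_auts" "\<tau> \<in> order_auts" "\<rho>' \<in> field_auts" "\<tau>' \<in> order_auts"
  shows "Psi K (\<rho>, \<tau>) = Psi K (\<rho>', \<tau>') \<longleftrightarrow> \<rho> = \<rho>' \<and> \<tau> = \<tau>'"
  using assms residue_Psi value_Psi by metis

lemma PsiG_inj: "inj_on \<Psi>G order_auts" and Psik_inj: "inj_on \<Psi>k field_auts"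
  by (auto simp: inj_on_def Psi_eq_iff)

lemma Psi_id: "Psi K (id, id) = (\<lambda>x\<in>K. x)"
  by (auto simp: Psi_def canonical_lift_def)

lemma Psi_inj: "inj_on (Psi K) (field_auts \<times> order_auts)"
  by (auto simp: inj_on_def Psi_eq_iff)

text \<open>The retraction onto \<open>ExtAut K\<close>.\<close>

definition canonical_part :: "(('g \<Rightarrow> 'k) \<Rightarrow> ('g \<Rightarrow> 'k)) \<Rightarrow> ('g \<Rightarrow> 'k) \<Rightarrow> ('g \<Rightarrow> 'k)"
  where "canonical_part \<sigma> = Psi K (residue_aut \<sigma>, value_aut K \<sigma>)"

lemma value_order: "\<sigma> \<in> stab_k (vAut K) \<Longrightarrow> value_aut K \<sigma> \<in> order_auts"
  by (simp add: V_iff value_aut_order)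

lemma residue_value_hom: "(\<lambda>\<sigma>. (residue_aut \<sigma>, value_aut K \<sigma>)) \<in> hom V (Aut_k \<times>\<times> oAut_G)"
  using residue_hom value_hom by (auto simp: hom_def)

lemma canonical_part_hom: "canonical_part \<in> hom V V"
  using hom_compose[OF residue_value_hom Psi_hom] by (simp add: o_def canonical_part_def[abs_def])

lemma canonical_part_Psi:
  "x \<in> field_auts \<times> order_auts \<Longrightarrow> canonical_part (Psi K x) = Psi K x"
  by (auto simp: canonical_part_def residue_Psi value_Psi)

lemma canonical_part_ExtAut: "\<sigma> \<in> stab_k (vAut K) \<Longrightarrow> canonical_part \<sigma> \<in> ExtAut K"
  by (simp add: canonical_part_def ExtAut_def residue_aut_field value_order)

lemma canonical_part_kernel:
  "fix_k (IntAut K) = {\<sigma> \<in> stab_k (vAut K). canonical_part \<sigma> = (\<lambda>x\<in>K. x)}"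
  unfolding Psi_id[symmetric] canonical_part_def
  by (auto simp: fix_IntAut_iff Psi_eq_iff residue_aut_field value_order)

lemma subgroup_kernel_V:
  assumes "h \<in> hom V Q" "group Q"
  shows "subgroup {\<sigma> \<in> stab_k (vAut K). h \<sigma> = \<one>\<^bsub>Q\<^esub>} V"
  using group_hom.subgroup_kernel[of V Q h] assms group_V
  by (simp add: group_hom_def group_hom_axioms_def kernel_def)

lemma subgroup_Int: "subgroup (fix_k (IntAut K)) V"
  using subgroup_kernel_V[OF canonical_part_hom group_V] by (simp add: canonical_part_kernel)

lemma group_Int: "group Int_k"
  using group.subgroup_imp_group[OF group_V subgroup_Int] by simp

lemma id_hom: "S \<subseteq> stab_k (vAut K) \<Longrightarrow> id \<in> hom (aut_group K S) V"
  by (auto simp: hom_def aut_group_def)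

lemma Int_sub_V: "fix_k (IntAut K) \<subseteq> stab_k (vAut K)"
  by (auto simp: fix_IntAut_iff)

lemma hom_restrict: "h \<in> hom V Q \<Longrightarrow> S \<subseteq> stab_k (vAut K) \<Longrightarrow> h \<in> hom (aut_group K S) Q"
  by (auto simp: hom_def aut_group_def)

section \<open>The semi-direct decompositions\<close>

lemma split_V: "split_subgroup V (stab_k (vAut K)) Int_k id (Aut_k \<times>\<times> oAut_G) (Psi K) canonical_part"
proof (intro split_subgroup.intro split_subgroup_axioms.intro)
  show "id ` carrier Int_k = {b \<in> stab_k (vAut K). canonical_part b = \<one>\<^bsub>V\<^esub>}"
    using canonical_part_kernel by simp
  show "id \<in> hom Int_k V" by (rule id_hom[OF Int_sub_V])
  show "Psi K x \<in> stab_k (vAut K)" if "x \<in> carrier (Aut_k \<times>\<times> oAut_G)" for x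
    using that Psi_in_V by auto
  show "canonical_part \<sigma> \<in> Psi K ` carrier (Aut_k \<times>\<times> oAut_G)" if "\<sigma> \<in> stab_k (vAut K)" for \<sigma>
    using canonical_part_ExtAut[OF that] by (simp add: ExtAut_def)
  show "subgroup (stab_k (vAut K)) V" using group.subgroup_self[OF group_V] by simp
qed (simp_all add: group_V group_Int DirProd_group[OF group_Aut_k group_oAut_G] Psi_hom Psi_inj
    canonical_part_hom canonical_part_Psi)

lemma ExtAut_stab: "ExtAut K = stab_k (ExtAut K)"
proof -
  have "\<sigma> ` range hconst = range hconst" if "\<sigma> \<in> ExtAut K" for \<sigma>
    using that Psi_in_V by (force simp: ExtAut_def V_iff)
  then show ?thesis unfolding stab_k_def by blast
qed

lemma inner_semidirect_V: "inner_semidirect V (fix_k (IntAut K)) (ExtAut K)"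
  using split_subgroup.inner_semidirect_of_split[OF split_V] by (simp add: ExtAut_def)

text \<open>
  That \<open>\<rho>\<^sub>x\<close> fixes the constants holds because \<open>x\<^sup>0 = 1\<close>.
\<close>

lemma rho_in_Int:
  assumes "x \<in> carrier Hom_G_kx"
  shows "rho K x \<in> fix_k (IntAut K)"
proof -
  have "rho K x \<in> IntAut K"
    using second_lifting assms by (auto simp: second_lifting_property_def hom_def)
  moreover have "rho K x (hconst c) = hconst c" for c
    by (auto simp: rho_def hconst_in_K) (auto simp: hconst_def character_0[OF assms])
  ultimately show ?thesis by (simp add: fix_k_def)
qed

lemma lead_char_rho: "lead_char (rho K x) = x"
  by (simp add: lead_char_def rho_def hmonom_in_K fun_eq_iff) (simp add: hmonom_def)

lemma rho_hom: "rho K \<in> hom Hom_G_kx V"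
  using second_lifting rho_in_Int Int_sub_V
  by (auto simp: second_lifting_property_def hom_def aut_group_def)

lemma rho_inj: "inj_on (rho K) (carrier Hom_G_kx)"
  by (rule inj_on_inverseI[of _ lead_char]) (rule lead_char_rho)

lemma rho_one: "rho K (\<lambda>g. 1) = (\<lambda>x\<in>K. x)"
  by (simp add: rho_def)

lemma fix_oneAut_iff:
  "\<sigma> \<in> fix_k (oneAut K) \<longleftrightarrow> \<sigma> \<in> fix_k (IntAut K) \<and> lead_char \<sigma> = \<one>\<^bsub>Hom_G_kx\<^esub>"
  by (auto simp: fix_k_def oneAut_def lead_char_def fun_eq_iff Hom_G_kx_def)

text \<open>
  The 1-automorphisms fixing \<open>k\<close> are those with trivial leading character.
\<close>

lemma group_One: "group One_k"
proof -
  have "subgroup (kernel Int_k Hom_G_kx lead_char) Int_k"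
    using group_hom.subgroup_kernel[of Int_k Hom_G_kx lead_char] lead_char_hom group_Int group_Hom_G_kx
    by (simp add: group_hom_def group_hom_axioms_def)
  moreover have "kernel Int_k Hom_G_kx lead_char = fix_k (oneAut K)"
    by (auto simp: kernel_def fix_oneAut_iff)
  ultimately show ?thesis using group.subgroup_imp_group[OF group_Int] by force
qed

lemma rho_trivial_iff: "rho K x = (\<lambda>x\<in>K. x) \<longleftrightarrow> x = \<one>\<^bsub>Hom_G_kx\<^esub>"
proof
  assume "rho K x = (\<lambda>x\<in>K. x)"
  also have "\<dots> = rho K (\<lambda>g. 1)" by (rule rho_one[symmetric])
  finally have "lead_char (rho K x) = lead_char (rho K (\<lambda>g. 1))" by (rule arg_cong)
  then show "x = \<one>\<^bsub>Hom_G_kx\<^esub>" unfolding lead_char_rho by (simp add: Hom_G_kx_def)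
next
  assume "x = \<one>\<^bsub>Hom_G_kx\<^esub>"
  then have "x = (\<lambda>g. 1)" by (simp add: Hom_G_kx_def)
  then show "rho K x = (\<lambda>x\<in>K. x)" using rho_one by blast
qed

lemma split_Int:
  "split_subgroup V (fix_k (IntAut K)) One_k id Hom_G_kx (rho K) (rho K \<circ> lead_char)"
proof (intro split_subgroup.intro split_subgroup_axioms.intro)
  show "id ` carrier One_k = {b \<in> fix_k (IntAut K). (rho K \<circ> lead_char) b = \<one>\<^bsub>V\<^esub>}"
    unfolding aut_group_simps o_apply rho_trivial_iff image_id id_apply
    using fix_oneAut_iff by blast
  show "id \<in> hom One_k V"
    using Int_sub_V by (intro id_hom) (auto simp: fix_oneAut_iff)
  show "rho K \<circ> lead_char \<in> hom (V\<lparr>carrier := fix_k (IntAut K)\<rparr>) V"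
    using hom_compose[OF lead_char_hom rho_hom] by simp
  show "(rho K \<circ> lead_char) \<sigma> \<in> rho K ` carrier Hom_G_kx" if "\<sigma> \<in> fix_k (IntAut K)" for \<sigma>
    unfolding o_apply by (rule imageI[OF lead_char_in_Hom[OF that]])
  show "(rho K \<circ> lead_char) (rho K x) = rho K x" for x
    unfolding o_apply lead_char_rho ..
  show "inj_on id (carrier One_k)" by (rule inj_on_id)
qed (rule group_V subgroup_Int group_One group_Hom_G_kx rho_hom rho_inj rho_in_Int; assumption?)+

abbreviation "One_Hom \<equiv> conj_semidirect V One_k id Hom_G_kx (rho K)"
abbreviation "e_One_Hom \<equiv> join_embed V id (rho K)"
abbreviation "G_k \<equiv> conj_semidirect V oAut_G \<Psi>G Aut_k \<Psi>k"
abbreviation "e_G_k \<equiv> join_embed V \<Psi>G \<Psi>k"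
abbreviation "Int_G \<equiv> conj_semidirect V Int_k id oAut_G \<Psi>G"
abbreviation "e_Int_G \<equiv> join_embed V id \<Psi>G"

text \<open>
  The product map of the inner decomposition identifies \<open>One_Hom\<close> with \<open>IntAut\<^sub>k K\<close>, the kernel of
  \<open>canonical_part\<close>.
\<close>

lemma split_V_One_Hom:
  "split_subgroup V (stab_k (vAut K)) One_Hom e_One_Hom (Aut_k \<times>\<times> oAut_G) (Psi K) canonical_part"
proof -
  interpret V: split_subgroup V "stab_k (vAut K)" Int_k id "Aut_k \<times>\<times> oAut_G" "Psi K" canonical_part
    by (rule split_V)
  interpret Int: split_subgroup V "fix_k (IntAut K)" One_k id Hom_G_kx "rho K" "rho K \<circ> lead_char"
    by (rule split_Int)
  show ?thesis
    using V.split_subgroup_axioms Int.join_embed_hom Int.join_embed_inj Int.join_embed_image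
      Int.group_semidirect
    by (simp add: split_subgroup_def split_subgroup_axioms_def)
qed

text \<open>
  Inside \<open>ExtAut K\<close> the two factors commute, so the semi-direct product is in fact direct. It is
  obtained from the retraction that forgets the part on values.
\<close>

lemma split_ExtAut:
  "split_subgroup V (ExtAut K) oAut_G \<Psi>G Aut_k \<Psi>k (\<Psi>k \<circ> residue_aut)"
proof -
  have "subgroup (ExtAut K) V"
    using inner_semidirect_V by (simp add: inner_semidirect_def)
  moreover have sub: "ExtAut K \<subseteq> stab_k (vAut K)" using Psi_in_V by (auto simp: ExtAut_def)
  moreover have "\<Psi>k \<circ> residue_aut \<in> hom (aut_group K (ExtAut K)) V"
    by (rule hom_compose[OF hom_restrict[OF residue_hom sub] Psik_hom])
  moreover have "\<Psi>G ` order_auts = {b \<in> ExtAut K. \<Psi>k (residue_aut b) = (\<lambda>x\<in>K. x)}"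
  proof (intro subset_antisym subsetI)
    fix b assume "b \<in> \<Psi>G ` order_auts"
    then obtain \<tau> where "\<tau> \<in> order_auts" "b = Psi K (id, \<tau>)" by blast
    then show "b \<in> {b \<in> ExtAut K. \<Psi>k (residue_aut b) = (\<lambda>x\<in>K. x)}"
      using residue_Psi[of id \<tau>] Psi_id by (simp add: ExtAut_def)
  next
    fix b assume b: "b \<in> {b \<in> ExtAut K. \<Psi>k (residue_aut b) = (\<lambda>x\<in>K. x)}"
    then obtain \<rho> \<tau> where x: "\<rho> \<in> field_auts" "\<tau> \<in> order_auts" "b = Psi K (\<rho>, \<tau>)"
      unfolding ExtAut_def by blast
    have "\<Psi>k (residue_aut b) = Psi K (id, id)" using b Psi_id by simp
    then have "\<rho> = id" using x residue_Psi[OF x(1,2)] Psi_eq_iff[of \<rho> id id id] by simp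
    then show "b \<in> \<Psi>G ` order_auts" using x by blast
  qed
  moreover have "\<Psi>k (residue_aut \<sigma>) \<in> \<Psi>k ` field_auts" if "\<sigma> \<in> ExtAut K" for \<sigma>
    using that sub by (auto intro: residue_aut_field)
  moreover have "\<Psi>k \<rho> \<in> ExtAut K" if "\<rho> \<in> field_auts" for \<rho>
    using that by (simp add: ExtAut_def)
  ultimately show ?thesis
    by (intro split_subgroup.intro split_subgroup_axioms.intro)
      (simp_all add: group_V group_Aut_k group_oAut_G PsiG_hom Psik_hom Psik_inj PsiG_inj residue_Psi)
qed

text \<open>
  The product map identifies \<open>G_k\<close> with \<open>ExtAut K\<close>, so the retraction onto \<open>ExtAut K\<close> serves again.
\<close>

lemma split_V_G_k:
  "split_subgroup V (stab_k (vAut K)) Int_k id G_k e_G_k canonical_part"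
proof -
  interpret V: split_subgroup V "stab_k (vAut K)" Int_k id "Aut_k \<times>\<times> oAut_G" "Psi K" canonical_part
    by (rule split_V)
  interpret Ext: split_subgroup V "ExtAut K" oAut_G \<Psi>G Aut_k \<Psi>k "\<Psi>k \<circ> residue_aut"
    by (rule split_ExtAut)
  have "e_G_k x \<in> ExtAut K" if "x \<in> carrier G_k" for x
    using that Ext.join_embed_image by blast
  moreover have "\<sigma> \<in> stab_k (vAut K)" "canonical_part \<sigma> = \<sigma>" if "\<sigma> \<in> ExtAut K" for \<sigma>
    using that canonical_part_Psi Psi_in_V by (auto simp: ExtAut_def)
  ultimately show ?thesis
    using V.group_axioms V.B V.N V.e Ext.group_semidirect Ext.join_embed_hom
      Ext.join_embed_inj V.p canonical_part_ExtAut Ext.join_embed_image V.kernel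
    by (intro split_subgroup.intro split_subgroup_axioms.intro) simp_all
qed

text \<open>
  The subgroup \<open>IntAut\<^sub>k K \<cdot> o-Aut G\<close>, described as the kernel of the residue map.
\<close>

abbreviation "residually_trivial \<equiv> {\<sigma> \<in> stab_k (vAut K). residue_aut \<sigma> = id}"

lemma split_residually_trivial:
  "split_subgroup V residually_trivial Int_k id oAut_G \<Psi>G (\<Psi>G \<circ> value_aut K)"
proof -
  have "\<one>\<^bsub>Aut_k :: ('k \<Rightarrow> 'k) monoid\<^esub> = id" by (auto simp: fun_eq_iff)
  then have "subgroup residually_trivial V"
    using subgroup_kernel_V[OF residue_hom group_Aut_k] by (simp only:)
  moreover have "\<Psi>G \<circ> value_aut K \<in> hom (aut_group K residually_trivial) V"
    by (rule hom_compose[OF hom_restrict[OF value_hom] PsiG_hom]) auto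
  moreover have "fix_k (IntAut K) = {\<sigma> \<in> residually_trivial. \<Psi>G (value_aut K \<sigma>) = (\<lambda>x\<in>K. x)}"
    unfolding Psi_id[symmetric]
    by (auto simp: fix_IntAut_iff Psi_eq_iff value_order)
  ultimately show ?thesis
    using group_Int id_hom[OF Int_sub_V]
    by (intro split_subgroup.intro split_subgroup_axioms.intro)
      (simp_all add: group_V group_oAut_G PsiG_hom value_order
        Psi_in_V PsiG_inj residue_Psi value_Psi)
qed

text \<open>
  Here \<open>Int_G\<close> names the kernel of the residue map, and the lifts of automorphisms of \<open>k\<close> split it.
\<close>

lemma split_V_Int_G:
  "split_subgroup V (stab_k (vAut K)) Int_G e_Int_G Aut_k \<Psi>k (\<Psi>k \<circ> residue_aut)"
proof -
  interpret R: split_subgroup V residually_trivial Int_k id oAut_G \<Psi>G "\<Psi>G \<circ> value_aut K"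
    by (rule split_residually_trivial)
  have "\<Psi>k \<circ> residue_aut \<in> hom V V"
    by (rule hom_compose[OF residue_hom Psik_hom])
  moreover have "residually_trivial = {\<sigma> \<in> stab_k (vAut K). \<Psi>k (residue_aut \<sigma>) = (\<lambda>x\<in>K. x)}"
    unfolding Psi_id[symmetric]
    by (auto simp: Psi_eq_iff residue_aut_field)
  ultimately show ?thesis
    using group.subgroup_self[OF group_V]
    by (intro split_subgroup.intro split_subgroup_axioms.intro)
      (simp_all add: group_V group_Aut_k Psik_hom residue_aut_field Psi_in_V R.join_embed_hom
        R.join_embed_inj R.join_embed_image R.group_semidirect Psik_inj residue_Psi)
qed

end

theorem proposition3p7p2:
  fixes K :: "('g::linordered_ab_group_add \<Rightarrow> 'k::field) set"
  assumes "hahn_field K"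
    and "first_lifting_property K"
    and "second_lifting_property K"
  defines "V \<equiv> aut_group K (stab_k (vAut K))"
    and "Int_k \<equiv> aut_group K (fix_k (IntAut K))"
    and "One_k \<equiv> aut_group K (fix_k (oneAut K))"
    and "\<Psi>G \<equiv> (\<lambda>\<tau>. Psi K (id, \<tau>))"
    and "\<Psi>k \<equiv> (\<lambda>\<rho>. Psi K (\<rho>, id))"
  defines "One_Hom \<equiv> conj_semidirect V One_k id Hom_G_kx (rho K)"
    and "e_One_Hom \<equiv> join_embed V id (rho K)"
    and "G_k \<equiv> conj_semidirect V oAut_G \<Psi>G Aut_k \<Psi>k"
    and "e_G_k \<equiv> join_embed V \<Psi>G \<Psi>k"
    and "Int_G \<equiv> conj_semidirect V Int_k id oAut_G \<Psi>G"
    and "e_Int_G \<equiv> join_embed V id \<Psi>G"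
  shows
    "ExtAut K = stab_k (ExtAut K)
   \<and> inner_semidirect V (fix_k (IntAut K)) (ExtAut K)
   \<and> (acts_by_conj V One_k id Hom_G_kx (rho K)
      \<and> acts_by_conj V One_Hom e_One_Hom (Aut_k \<times>\<times> oAut_G) (Psi K)
      \<and> V \<cong> conj_semidirect V One_Hom e_One_Hom (Aut_k \<times>\<times> oAut_G) (Psi K))
   \<and> (acts_by_conj V oAut_G \<Psi>G Aut_k \<Psi>k
      \<and> acts_by_conj V Int_k id G_k e_G_k
      \<and> acts_by_conj V Int_k id oAut_G \<Psi>G
      \<and> acts_by_conj V Int_G e_Int_G Aut_k \<Psi>k
      \<and> V \<cong> conj_semidirect V Int_k id G_k e_G_k
      \<and> conj_semidirect V Int_k id G_k e_G_k \<cong> conj_semidirect V Int_G e_Int_G Aut_k \<Psi>k)"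
proof -
  interpret hahn_lifting K by unfold_locales (rule assms)+
  note acts = split_subgroup.acts and iso = split_subgroup.iso_semidirect
  \<comment> \<open>the local definitions repeat abbreviations of \<open>hahn_lifting\<close>, so unfolding them matches its lemmas\<close>
  have V_G_k: "V \<cong> conj_semidirect V Int_k id G_k e_G_k"
    unfolding assms(4-) by (rule iso[OF split_V_G_k]) simp
  have "V \<cong> conj_semidirect V Int_G e_Int_G Aut_k \<Psi>k"
    unfolding assms(4-) by (rule iso[OF split_V_Int_G]) simp
  moreover have "conj_semidirect V Int_k id G_k e_G_k \<cong> V"
    using V_G_k group.iso_sym[OF group_V] by (simp only: V_def)
  ultimately have "conj_semidirect V Int_k id G_k e_G_k \<cong> conj_semidirect V Int_G e_Int_G Aut_k \<Psi>k"
    by (rule iso_trans[rotated])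
  moreover have "V \<cong> conj_semidirect V One_Hom e_One_Hom (Aut_k \<times>\<times> oAut_G) (Psi K)"
    unfolding assms(4-) by (rule iso[OF split_V_One_Hom]) simp
  moreover have "acts_by_conj V One_k id Hom_G_kx (rho K)"
    "acts_by_conj V One_Hom e_One_Hom (Aut_k \<times>\<times> oAut_G) (Psi K)"
    "acts_by_conj V oAut_G \<Psi>G Aut_k \<Psi>k"
    "acts_by_conj V Int_k id G_k e_G_k"
    "acts_by_conj V Int_k id oAut_G \<Psi>G"
    "acts_by_conj V Int_G e_Int_G Aut_k \<Psi>k"
    unfolding assms(4-)
    by (rule acts[OF split_Int] acts[OF split_V_One_Hom] acts[OF split_ExtAut] acts[OF split_V_G_k]
        acts[OF split_residually_trivial] acts[OF split_V_Int_G])+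
  moreover have "inner_semidirect V (fix_k (IntAut K)) (ExtAut K)"
    unfolding V_def by (rule inner_semidirect_V)
  moreover have "ExtAut K = stab_k (ExtAut K)" by (rule ExtAut_stab)
  ultimately show ?thesis using V_G_k by (intro conjI)
qed

end
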